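(* Let $J_n$ be the number of distinct plane trees occurring among the fringe subtrees of a random binary increasing tree of size $n$ (fringe subtrees identified if they have the same shape as plane trees, i.e. forgetting labels and left/right positions but keeping the order of children). For $$c_{15}=4\sum_{k\ge2}\frac{\log k-\frac{2\log2}{k}}{(k+1)(k+2)}=4\sum_{k\ge2}\frac{\log k}{(k+1)(k+2)}-\frac{2\log2}{3}\approx1.9450317130$$ and $c_{16}=2\log3$: (i) $\frac{c_{15}n}{\log n}(1+o(1))\le\mathbb{E}(J_n)\le\frac{c_{16}n}{\log n}(1+o(1))$; (ii) with probability tending to $1$, $\frac{c_{15}n}{\log n}(1+o(1))\le J_n\le\frac{c_{16}n}{\log n}(1+o(1))$.
   Context: A binary increasing tree of size $n$ is a binary tree (each vertex has a left and a right position for children) with vertices labelled $1,\dots,n$ increasingly along paths from the root; a random one is uniform among the $n!$ such trees (equivalently a random binary search tree). A fringe subtree is a vertex with all descendants. *)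

theory Defs
  imports "HOL-Probability.Probability" "HOL-Library.Tree" "HOL-Combinatorics.Multiset_Permutations"
begin

text \<open>
  A vertex of a binary tree is a \<^const>\<open>Node\<close>; a \<^const>\<open>Leaf\<close> is an empty left or right position.
  The conditions on the label set and the size say that each of the labels \<open>1, \<dots>, n\<close> is used
  exactly once, so that the weak inequalities of \<^const>\<open>heap\<close> are strict.
\<close>

definition binary_increasing_trees :: "nat \<Rightarrow> nat tree set" where
  "binary_increasing_trees n = {t. heap t \<and> set_tree t = {1..n} \<and> size t = n}"

definition random_binary_increasing_tree :: "nat \<Rightarrow> nat tree pmf" where
  "random_binary_increasing_tree n = pmf_of_set (binary_increasing_trees n)"

definition fringe_subtrees :: "'a tree \<Rightarrow> 'a tree set" where
  "fringe_subtrees t = subtrees t - {Leaf}"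

datatype plane_tree = Plane_Node "plane_tree list"

text \<open>Unspecified on \<^const>\<open>Leaf\<close>, since the empty tree has no plane shape.\<close>

fun plane_shape :: "'a tree \<Rightarrow> plane_tree" where
  "plane_shape (Node l a r) =
     Plane_Node ((if l = Leaf then [] else [plane_shape l]) @
                 (if r = Leaf then [] else [plane_shape r]))"

definition num_plane_fringe_shapes :: "'a tree \<Rightarrow> nat" where
  "num_plane_fringe_shapes t = card (plane_shape ` fringe_subtrees t)"

definition c15 :: real where
  "c15 = 4 * (\<Sum>\<^sub>\<infinity>k\<in>{2::nat..}. (ln (real k) - 2 * ln 2 / real k) / ((real k + 1) * (real k + 2)))"

definition c16 :: real where
  "c16 = 2 * ln 3"

lemma inorder_heap_inj:
  fixes s t :: "nat tree"
  assumes "heap s" "heap t" "distinct (inorder s)" "inorder s = inorder t"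
  shows "s = t"
  using assms
proof (induction s arbitrary: t)
  case Leaf
  then show ?case by (cases t) auto
next
  case (Node l a r)
  obtain l' b r' where t: "t = Node l' b r'"
    using Node.prems(4) by (cases t) auto
  have eq: "inorder l @ a # inorder r = inorder l' @ b # inorder r'"
    using Node.prems(4) t by simp
  have "set (inorder (Node l a r)) = set (inorder t)"
    using Node.prems(4) by simp
  then have sets: "set_tree (Node l a r) = set_tree t" by (simp only: set_inorder)
  have "a \<in> set_tree t" "b \<in> set_tree (Node l a r)" using sets t by auto
  then have "a = b" using Node.prems(1,2) t by (auto intro: antisym)
  moreover have "a \<notin> set (inorder l)" "a \<notin> set (inorder r)"
    using Node.prems(3) by auto
  moreover have "distinct (inorder t)"
    using Node.prems(3) unfolding Node.prems(4) .
  then have "b \<notin> set (inorder l')" "b \<notin> set (inorder r')"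
    using t by auto
  ultimately have "inorder l = inorder l'" "inorder r = inorder r'"
    using eq by (auto simp: append_Cons_eq_iff)
  then show ?case
    using Node.IH(1)[of l'] Node.IH(2)[of r'] Node.prems t \<open>a = b\<close> by auto
qed

lemma ex_heap_inorder:
  fixes xs :: "nat list"
  shows "\<exists>t. heap t \<and> inorder t = xs"
proof (induction xs rule: length_induct)
  case (1 xs)
  show ?case
  proof (cases "xs = []")
    case True
    then show ?thesis by (intro exI[of _ Leaf]) simp
  next
    case False
    define m where "m = Min (set xs)"
    have "m \<in> set xs" using False m_def by simp
    then obtain ys zs where xs: "xs = ys @ m # zs"
      by (meson split_list)
    obtain l r where l: "heap l" "inorder l = ys" and r: "heap r" "inorder r = zs"
      using 1[rule_format, of ys] 1[rule_format, of zs] xs by auto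
    have "\<forall>x\<in>set xs. m \<le> x" using m_def by simp
    then have "\<forall>x\<in>set_tree l \<union> set_tree r. m \<le> x"
      using xs l(2) r(2) by (auto simp flip: set_inorder)
    then show ?thesis
      using l r xs by (intro exI[of _ "Node l m r"]) simp
  qed
qed

lemma bij_betw_inorder_binary_increasing_trees:
  "bij_betw inorder (binary_increasing_trees n) (permutations_of_set {1..n})"
proof -
  have dist: "distinct (inorder t)" if "set_tree t = {1..n}" "size t = n" for t :: "nat tree"
    using that by (intro card_distinct) simp
  have "inj_on inorder (binary_increasing_trees n)"
    using dist by (intro inj_onI) (auto simp: binary_increasing_trees_def intro!: inorder_heap_inj)
  moreover have "inorder ` binary_increasing_trees n = permutations_of_set {1..n}"
  proof (intro equalityI subsetI)
    fix xs assume "xs \<in> permutations_of_set {1..n}"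
    then have xs: "set xs = {1..n}" "length xs = n"
      by (auto simp: permutations_of_set_def dest: distinct_card)
    obtain t :: "nat tree" where t: "heap t" "inorder t = xs"
      using ex_heap_inorder by blast
    then have "t \<in> binary_increasing_trees n"
      using xs unfolding binary_increasing_trees_def
      by (auto simp flip: set_inorder length_inorder)
    then show "xs \<in> inorder ` binary_increasing_trees n" using t by blast
  qed (use dist in \<open>auto simp: binary_increasing_trees_def permutations_of_set_def\<close>)
  ultimately show ?thesis by (simp add: bij_betw_def)
qed

lemma finite_binary_increasing_trees: "finite (binary_increasing_trees n)"
  using bij_betw_finite[OF bij_betw_inorder_binary_increasing_trees] by simp

lemma card_binary_increasing_trees: "card (binary_increasing_trees n) = fact n"
  using bij_betw_same_card[OF bij_betw_inorder_binary_increasing_trees] by simp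

lemma binary_increasing_trees_nonempty: "binary_increasing_trees n \<noteq> {}"
  using card_binary_increasing_trees[of n] by force

end

(*  For a size-based toll f, the additive functional F(t) = f(|l|, |r|) + F(l) + F(r) of a random
    binary search tree has an explicit mean which is linear up to a bounded error; its variance is
    therefore linear. In particular the number of fringe subtrees of size at least k has mean about
    2n/k, with fluctuations O(sqrt n).

    Upper bound: there are at most 3^k unary-binary plane trees with at most k vertices, so at most
    3^k + #{fringe subtrees of size >= k} shapes occur; take k slightly below log_3 n.

    Lower bound: a plane shape S has probability 2^u / prod |S_v|, u being the number of unary
    vertices, so -log P is an additive functional and a random tree of size k has a shape of
    probability at most exp(-(c15/2 - o(1)) k), except with small probability. For k slightly above
    2 (log n) / c15, almost all of the ~ 2n/k fringe subtrees of size >= k have such an unlikely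
    shape, and the expected number of coincidences among them is o(n / log n). Truncating the
    logarithmic tolls at a fixed size K keeps them bounded and loses only o(1) in the rate.  *)

theory Submission
  imports Defs "HOL-Real_Asymp.Real_Asymp"
begin

section \<open>Averages over random binary search trees\<close>

text \<open>Randomness enters only through \<open>bst_avg\<close>: the left size is uniform, and
  given the sizes the two subtrees are independent. Every moment is thus an induction on the size,
  and measure theory is confined to the passage from increasing trees to this average.

  The factor 2 in both constants is the 2 of the mean 2n/k. The threshold for the lower bound is
  dictated by a first moment estimate: given one subtree, a shape of probability at most p is
  expected at most p times the size often in the other, so at most about p n^2 repetitions are
  expected. With p = exp(-\<rho> k) this is o(n / log n) once \<rho> k exceeds log n by a constant
  factor. A few shapes are far likelier than typical and would spoil the estimate, so shapes are
  split into good and bad by their probability, and repetitions are counted among good ones only.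

  Statements (i) and (ii) are proved together: each side is an inequality between J, a deterministic
  main term and a nonnegative error \<open>Y\<close>. A bound on the mean of \<open>Y\<close>
  settles the expectation directly and the probability by Markov's inequality.\<close>

function bst_avg :: "nat \<Rightarrow> (unit tree \<Rightarrow> real) \<Rightarrow> real" where
  "bst_avg 0 g = g Leaf"
| "bst_avg (Suc m) g =
     (\<Sum>j\<le>m. bst_avg j (\<lambda>l. bst_avg (m - j) (\<lambda>r. g (Node l () r)))) / real (Suc m)"
  by pat_completeness auto
termination by (relation "Wellfounded.measure fst") auto

lemma bst_avg_cong:
  assumes "\<And>t. size t = n \<Longrightarrow> g t = h t"
  shows "bst_avg n g = bst_avg n h"
  using assms
proof (induction n arbitrary: g h rule: less_induct)
  case (less n)
  show ?case
  proof (cases n)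
    case (Suc m)
    have "bst_avg j (\<lambda>l. bst_avg (m - j) (\<lambda>r. g (Node l () r))) =
          bst_avg j (\<lambda>l. bst_avg (m - j) (\<lambda>r. h (Node l () r)))" if "j \<le> m" for j
      using that Suc by (intro less.IH less.prems) auto
    then show ?thesis using Suc by simp
  qed (use less.prems in simp)
qed

lemma bst_avg_add: "bst_avg n (\<lambda>t. g t + h t) = bst_avg n g + bst_avg n h"
proof (induction n arbitrary: g h rule: less_induct)
  case (less n)
  show ?case
  proof (cases n)
    case (Suc m)
    have "bst_avg j (\<lambda>l. bst_avg (m - j) (\<lambda>r. g (Node l () r) + h (Node l () r))) =
          bst_avg j (\<lambda>l. bst_avg (m - j) (\<lambda>r. g (Node l () r))) +
          bst_avg j (\<lambda>l. bst_avg (m - j) (\<lambda>r. h (Node l () r)))" if "j \<le> m" for j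
      using that Suc by (simp add: less.IH)
    then show ?thesis using Suc by (simp add: sum.distrib add_divide_distrib)
  qed simp
qed

lemma bst_avg_cmult: "bst_avg n (\<lambda>t. c * g t) = c * bst_avg n g"
proof (induction n arbitrary: g rule: less_induct)
  case (less n)
  show ?case
  proof (cases n)
    case (Suc m)
    have "bst_avg j (\<lambda>l. bst_avg (m - j) (\<lambda>r. c * g (Node l () r))) =
          c * bst_avg j (\<lambda>l. bst_avg (m - j) (\<lambda>r. g (Node l () r)))" if "j \<le> m" for j
      using that Suc by (simp add: less.IH)
    then show ?thesis using Suc by (simp add: sum_distrib_left)
  qed simp
qed

lemma bst_avg_multc: "bst_avg n (\<lambda>t. g t * c) = bst_avg n g * c"
  using bst_avg_cmult[of n c g] by (simp add: mult.commute)

lemma bst_avg_mono: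
  assumes "\<And>t. size t = n \<Longrightarrow> g t \<le> h t"
  shows "bst_avg n g \<le> bst_avg n h"
  using assms
proof (induction n arbitrary: g h rule: less_induct)
  case (less n)
  show ?case
  proof (cases n)
    case (Suc m)
    have "bst_avg j (\<lambda>l. bst_avg (m - j) (\<lambda>r. g (Node l () r))) \<le>
          bst_avg j (\<lambda>l. bst_avg (m - j) (\<lambda>r. h (Node l () r)))" if "j \<le> m" for j
      using that Suc by (intro less.IH less.prems) auto
    then show ?thesis using Suc by (auto intro!: divide_right_mono sum_mono)
  qed (use less.prems in simp)
qed

lemma bst_avg_const [simp]: "bst_avg n (\<lambda>_. c) = c"
proof (induction n arbitrary: c rule: less_induct)
  case (less n)
  then show ?case by (cases n) auto
qed

lemma bst_avg_diff: "bst_avg n (\<lambda>t. g t - h t) = bst_avg n g - bst_avg n h"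
  using bst_avg_add[of n g "\<lambda>t. -1 * h t"] bst_avg_cmult[of n "-1" h] by simp

lemma bst_avg_sum: "bst_avg n (\<lambda>t. \<Sum>i\<in>I. g i t) = (\<Sum>i\<in>I. bst_avg n (g i))"
  by (induction I rule: infinite_finite_induct) (simp_all add: bst_avg_add)

lemma bst_avg_nonneg: "(\<And>t. size t = n \<Longrightarrow> 0 \<le> g t) \<Longrightarrow> 0 \<le> bst_avg n g"
  using bst_avg_mono[of n "\<lambda>_. 0" g] by simp

lemma bst_avg_markov:
  assumes "\<And>t. size t = n \<Longrightarrow> 0 \<le> g t" "\<And>t. size t = n \<Longrightarrow> P t \<Longrightarrow> a \<le> g t" "a > 0"
  shows "bst_avg n (\<lambda>t. of_bool (P t)) \<le> bst_avg n g / a"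
proof -
  have "bst_avg n (\<lambda>t. of_bool (P t)) \<le> bst_avg n (\<lambda>t. inverse a * g t)"
    using assms by (intro bst_avg_mono) (auto simp: field_simps)
  then show ?thesis by (simp add: bst_avg_cmult divide_inverse_commute)
qed

text \<open>Induction needs arbitrary label sets, since the subtrees of an increasing tree carry
  subsets of the labels. As in \<open>binary_increasing_trees\<close>, the size condition excludes
  repeated labels.\<close>

definition heaps :: "nat set \<Rightarrow> nat tree set" where
  "heaps A = {t. heap t \<and> set_tree t = A \<and> size t = card A}"

abbreviation unlabel :: "'a tree \<Rightarrow> unit tree" where
  "unlabel \<equiv> map_tree (\<lambda>_. ())"

lemma distinct_inorder_heaps: "t \<in> heaps A \<Longrightarrow> distinct (inorder t)"
  by (intro card_distinct) (auto simp: heaps_def)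

lemma finite_heaps: "finite A \<Longrightarrow> finite (heaps A)"
proof (rule inj_on_finite)
  show "inj_on inorder (heaps A)"
    by (intro inj_onI inorder_heap_inj) (auto simp: heaps_def distinct_inorder_heaps)
  show "inorder ` heaps A \<subseteq> permutations_of_set A"
    by (auto simp: permutations_of_set_def distinct_inorder_heaps heaps_def)
qed auto

lemma heaps_decomp:
  assumes "finite A" "A \<noteq> {}"
  defines "m \<equiv> Min A"
  shows "heaps A =
    (\<Union>B\<in>Pow (A - {m}). (\<lambda>(l, r). Node l m r) ` (heaps B \<times> heaps (A - {m} - B)))"
proof (intro equalityI subsetI)
  fix t assume t: "t \<in> heaps A"
  then obtain l a r where Node: "t = Node l a r"
    using assms by (cases t) (auto simp: heaps_def)
  have a: "a = m" using t assms unfolding Node heaps_def m_def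
    by (intro Min_eqI[symmetric]) auto
  \<comment> \<open>No label repeats, so the label sets of the two subtrees are disjoint and the
    right one is the complement of the left one.\<close>
  have d: "distinct (inorder l)" "distinct (inorder r)" "a \<notin> set_tree l" "a \<notin> set_tree r"
    "set_tree l \<inter> set_tree r = {}"
    using distinct_inorder_heaps[OF t] by (auto simp: Node)
  have sz: "size l = card (set_tree l)" "size r = card (set_tree r)"
    using d(1,2)[THEN distinct_card] by auto
  have "l \<in> heaps (set_tree l)" "r \<in> heaps (A - {m} - set_tree l)" "set_tree l \<in> Pow (A - {m})"
    using t d sz a unfolding Node heaps_def by (auto intro: arg_cong[where f = card])
  then show "t \<in> (\<Union>B\<in>Pow (A - {m}). (\<lambda>(l, r). Node l m r) ` (heaps B \<times> heaps (A - {m} - B)))"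
    using Node a by (intro UN_I[of "set_tree l"]) auto
next
  fix t assume "t \<in> (\<Union>B\<in>Pow (A - {m}). (\<lambda>(l, r). Node l m r) ` (heaps B \<times> heaps (A - {m} - B)))"
  then obtain B l r where *: "B \<subseteq> A - {m}" "l \<in> heaps B" "r \<in> heaps (A - {m} - B)" "t = Node l m r"
    by auto
  have "m \<in> A" "\<forall>x\<in>A. m \<le> x" using assms by auto
  moreover have "card B + card (A - {m} - B) = card (A - {m})"
    using *(1) assms(1) card_mono[of "A - {m}" B] by (simp add: card_Diff_subset finite_subset)
  ultimately show "t \<in> heaps A"
    using * assms(1) card_Suc_Diff1[OF assms(1) \<open>m \<in> A\<close>] by (auto simp: heaps_def)
qed

lemma sum_Pow_card:
  assumes "finite C"
  shows "(\<Sum>B\<in>Pow C. h (card B)) = (\<Sum>j\<le>card C. real (card C choose j) * h j)"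
proof -
  have "(\<Sum>B\<in>Pow C. h (card B)) = (\<Sum>j\<le>card C. \<Sum>B\<in>{B \<in> Pow C. card B = j}. h (card B))"
    using assms by (intro sum.group[symmetric]) (auto intro: card_mono)
  also have "\<dots> = (\<Sum>j\<le>card C. real (card C choose j) * h j)"
    using n_subsets[OF assms] by (intro sum.cong) (auto simp: Pow_def)
  finally show ?thesis .
qed

text \<open>The minimum sits at the root, and the labels of the left subtree may be any subset of the
  others; the binomial coefficient counting these subsets makes the left size uniform.\<close>

lemma sum_heaps_unlabel:
  "finite A \<Longrightarrow> (\<Sum>t\<in>heaps A. g (unlabel t)) = fact (card A) * bst_avg (card A) g"
proof (induction "card A" arbitrary: A g rule: less_induct)
  case less
  show ?case
  proof (cases "A = {}")
    case True
    have "heaps {} = {Leaf}" by (auto simp: heaps_def)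
    with True show ?thesis by simp
  next
    case False
    define m C where "m = Min A" and "C = A - {m}"
    have m: "m \<in> A" using False less.prems m_def by simp
    then obtain k where k: "card A = Suc k" "card C = k"
      using less.prems C_def by (metis card_Suc_Diff1)
    have finC: "finite C" using less.prems C_def by simp
    have split: "card (C - B) = k - card B" "finite B" "finite (C - B)" "card B \<le> k"
      if "B \<in> Pow C" for B
      using that finC k by (auto simp: card_Diff_subset finite_subset intro: card_mono)
    \<comment> \<open>The pieces are disjoint because \<open>B\<close> is recovered as the label set
      of the left subtree.\<close>
    have "(\<Sum>t\<in>heaps A. g (unlabel t)) =
      (\<Sum>B\<in>Pow C. \<Sum>t\<in>(\<lambda>(l, r). Node l m r) ` (heaps B \<times> heaps (C - B)). g (unlabel t))"
      unfolding heaps_decomp[OF less.prems False] m_def[symmetric] C_def[symmetric]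
      using finC split
      by (intro sum.UNION_disjoint ballI finite_imageI finite_cartesian_product finite_heaps)
         (auto simp: heaps_def)
    also have "\<dots> = (\<Sum>B\<in>Pow C. \<Sum>l\<in>heaps B. \<Sum>r\<in>heaps (C - B). g (Node (unlabel l) () (unlabel r)))"
      by (rule sum.cong[OF refl], subst sum.reindex)
         (auto simp: inj_on_def sum.cartesian_product case_prod_unfold)
    also have "\<dots> = (\<Sum>B\<in>Pow C. fact (card B) * fact (k - card B) *
        bst_avg (card B) (\<lambda>l. bst_avg (k - card B) (\<lambda>r. g (Node l () r))))" (is "_ = (\<Sum>B\<in>_. ?h (card B))")
    proof (intro sum.cong refl)
      fix B assume B: "B \<in> Pow C"
      have "(\<Sum>l\<in>heaps B. \<Sum>r\<in>heaps (C - B). g (Node (unlabel l) () (unlabel r))) =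
        (\<Sum>l\<in>heaps B. fact (k - card B) * bst_avg (k - card B) (\<lambda>r. g (Node (unlabel l) () r)))"
      proof (intro sum.cong refl)
        fix l assume "l \<in> heaps B"
        show "(\<Sum>r\<in>heaps (C - B). g (Node (unlabel l) () (unlabel r))) =
            fact (k - card B) * bst_avg (k - card B) (\<lambda>r. g (Node (unlabel l) () r))"
          using split[OF B] k less.hyps[of "C - B" "\<lambda>r. g (Node (unlabel l) () r)"] by simp
      qed
      also have "\<dots> = fact (card B) * (fact (k - card B) *
          bst_avg (card B) (\<lambda>l. bst_avg (k - card B) (\<lambda>r. g (Node l () r))))"
        using split[OF B] k
          less.hyps[of B "\<lambda>l. fact (k - card B) * bst_avg (k - card B) (\<lambda>r. g (Node l () r))"]
        by (simp add: bst_avg_cmult)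
      finally show "(\<Sum>l\<in>heaps B. \<Sum>r\<in>heaps (C - B). g (Node (unlabel l) () (unlabel r))) = ?h (card B)"
        by simp
    qed
    also have "\<dots> = (\<Sum>j\<le>k. real (k choose j) * ?h j)"
      by (subst sum_Pow_card[OF finC]) (simp add: k)
    also have "\<dots> = (\<Sum>j\<le>k. fact k * bst_avg j (\<lambda>l. bst_avg (k - j) (\<lambda>r. g (Node l () r))))"
    proof (intro sum.cong refl)
      fix j assume "j \<in> {..k}"
      then have eq: "fact j * fact (k - j) * real (k choose j) = fact k"
        using binomial_fact_lemma[of j k] by (metis atMost_iff of_nat_fact of_nat_mult)
      show "real (k choose j) * ?h j =
          fact k * bst_avg j (\<lambda>l. bst_avg (k - j) (\<lambda>r. g (Node l () r)))"
        unfolding eq[symmetric] by (simp only: mult_ac)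
    qed
    also have "\<dots> = fact (card A) * bst_avg (card A) g"
      by (simp add: k sum_distrib_left[symmetric])
    finally show ?thesis .
  qed
qed

lemma expectation_random_binary_increasing_tree:
  assumes "\<And>t. f t = g (unlabel t)"
  shows "measure_pmf.expectation (random_binary_increasing_tree n) f = bst_avg n g"
proof -
  have "binary_increasing_trees n = heaps {1..n}"
    by (auto simp: heaps_def binary_increasing_trees_def)
  then have "(\<Sum>t\<in>binary_increasing_trees n. f t) = fact n * bst_avg n g"
    using sum_heaps_unlabel[of "{1..n}" g] by (simp add: assms)
  then show ?thesis
    unfolding random_binary_increasing_tree_def
    by (simp add: integral_pmf_of_set binary_increasing_trees_nonempty finite_binary_increasing_trees
        card_binary_increasing_trees)
qed

lemma prob_random_binary_increasing_tree:
  assumes "\<And>t. P t \<longleftrightarrow> Q (unlabel t)"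
  shows "measure_pmf.prob (random_binary_increasing_tree n) {t. P t} = bst_avg n (\<lambda>t. of_bool (Q t))"
proof -
  have "measure_pmf.prob (random_binary_increasing_tree n) {t. P t} =
      measure_pmf.expectation (random_binary_increasing_tree n) (indicator {t. P t})"
    by simp
  also have "\<dots> = bst_avg n (\<lambda>t. of_bool (Q t))"
    by (intro expectation_random_binary_increasing_tree) (auto simp: assms indicator_def)
  finally show ?thesis .
qed

section \<open>Additive functionals\<close>

text \<open>A sum over vertices: equal subtrees at different vertices count separately, whereas
  \<open>fringe_subtrees\<close> is a set and merges them, which does happen once labels are
  erased.\<close>

fun fringe_sum :: "('a tree \<Rightarrow> real) \<Rightarrow> 'a tree \<Rightarrow> real" where
  "fringe_sum f Leaf = 0"
| "fringe_sum f (Node l a r) = f (Node l a r) + fringe_sum f l + fringe_sum f r"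

lemma fringe_sum_mono: "(\<And>t. f t \<le> g t) \<Longrightarrow> fringe_sum f t \<le> fringe_sum g t"
  by (induction t) (auto intro!: add_mono)

lemma fringe_sum_nonneg: "(\<And>t. 0 \<le> f t) \<Longrightarrow> 0 \<le> fringe_sum f t"
  by (induction t) auto

lemma fringe_sum_add: "fringe_sum (\<lambda>t. f t + g t) t = fringe_sum f t + fringe_sum g t"
  by (induction t) auto

lemma sum_atMost_rev: "(\<Sum>j\<le>m. g (m - j)) = (\<Sum>j\<le>(m::nat). g j)"
  by (rule sum.reindex_bij_witness[of _ "\<lambda>j. m - j" "\<lambda>j. m - j"]) auto

lemma sum_real_atMost: "(\<Sum>j\<le>m. real j) = real m * (real m + 1) / 2"
  by (induction m) (auto simp: field_simps)

text \<open>The quicksort recurrence; the factor 2 appears because the right size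
  \<open>m - j\<close> runs through the same values as \<open>j\<close>.\<close>

lemma bst_avg_additive:
  assumes "\<And>l r. F (Node l () r) = f (Node l () r) + F l + F r"
  shows "bst_avg (Suc m) F = bst_avg (Suc m) f + 2 / real (Suc m) * (\<Sum>j\<le>m. bst_avg j F)"
proof -
  have "bst_avg (Suc m) F = (\<Sum>j\<le>m. bst_avg j (\<lambda>l. bst_avg (m - j) (\<lambda>r. f (Node l () r)))
      + bst_avg j F + bst_avg (m - j) F) / real (Suc m)"
    by (simp add: assms bst_avg_add)
  also have "\<dots> = bst_avg (Suc m) f + ((\<Sum>j\<le>m. bst_avg j F) + (\<Sum>j\<le>m. bst_avg (m - j) F)) / real (Suc m)"
    by (simp add: sum.distrib add_divide_distrib)
  also have "\<dots> = bst_avg (Suc m) f + 2 / real (Suc m) * (\<Sum>j\<le>m. bst_avg j F)"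
    using sum_atMost_rev[of "\<lambda>j. bst_avg j F" m] by simp
  finally show ?thesis .
qed

text \<open>Comparison principle: any supersolution \<open>b\<close> of the recurrence dominates the
  mean. Only the average of the toll has to be controlled, so tolls depending on the whole subtrees
  are allowed.\<close>

lemma bst_avg_additive_le:
  assumes F: "\<And>l r. F (Node l () r) = f (Node l () r) + F l + F r"
    and b: "F Leaf \<le> b 0"
      "\<And>m. bst_avg (Suc m) f + 2 / real (Suc m) * (\<Sum>j\<le>m. b j) \<le> b (Suc m)"
  shows "bst_avg n F \<le> b n"
proof (induction n rule: less_induct)
  case (less n)
  show ?case
  proof (cases n)
    case (Suc m)
    have "(\<Sum>j\<le>m. bst_avg j F) \<le> (\<Sum>j\<le>m. b j)"
      using less Suc by (intro sum_mono) auto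
    then have "bst_avg n F \<le> bst_avg (Suc m) f + 2 / real (Suc m) * (\<Sum>j\<le>m. b j)"
      unfolding Suc bst_avg_additive[of F f, OF F] by (intro add_left_mono mult_left_mono) auto
    then show ?thesis using b(2)[of m] Suc by simp
  qed (use b in simp)
qed

lemma bst_avg_additive_linear:
  assumes "\<And>l r. F (Node l () r) = f (Node l () r) + F l + F r" "F Leaf = 0"
    and "\<And>m. bst_avg (Suc m) f \<le> p"
  shows "bst_avg n F \<le> p * real n"
proof (rule bst_avg_additive_le[of F f])
  fix m
  have "2 / real (Suc m) * (\<Sum>j\<le>m. p * real j) = p * real m"
    unfolding sum_distrib_left[symmetric] sum_real_atMost by (simp add: field_simps)
  then show "bst_avg (Suc m) f + 2 / real (Suc m) * (\<Sum>j\<le>m. p * real j) \<le> p * real (Suc m)"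
    using assms(3)[of m] by (simp add: algebra_simps)
qed (use assms in auto)

text \<open>The partial sums of the means satisfy a first-order recurrence that telescopes after
  division by \<open>(m + 1) * (m + 2)\<close>. The weights \<open>2 / ((k + 1) * (k + 2))\<close>,
  the limiting frequencies of fringe subtrees of size \<open>k\<close>, are the source of the
  denominators in \<open>c15\<close>.\<close>

lemma bst_avg_additive_closed_form:
  assumes F: "\<And>l r. F (Node l () r) = f (Node l () r) + F l + F r" and "F Leaf = 0" and "n > 0"
  shows "bst_avg n F =
    (real n + 1) * (\<Sum>k=1..<n. 2 * bst_avg k f / ((real k + 1) * (real k + 2))) + bst_avg n f"
proof -
  define c where "c m = (\<Sum>k=1..<Suc m. 2 * bst_avg k f / ((real k + 1) * (real k + 2)))" for m
  note rec = bst_avg_additive[of F f, OF F]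
  have S: "(\<Sum>j\<le>m. bst_avg j F) = (real m + 1) * (real m + 2) / 2 * c m" for m
  proof (induction m)
    case 0
    then show ?case using assms by (simp add: c_def)
  next
    case (Suc m)
    have c: "c (Suc m) = c m + 2 * bst_avg (Suc m) f / ((real m + 2) * (real m + 3))"
      by (simp add: c_def add_ac del: bst_avg.simps)
    have "(\<Sum>j\<le>Suc m. bst_avg j F) =
        (1 + 2 / real (Suc m)) * (\<Sum>j\<le>m. bst_avg j F) + bst_avg (Suc m) f"
      using rec[of m] by (simp add: algebra_simps del: bst_avg.simps)
    also have "(1 + 2 / real (Suc m)) * (\<Sum>j\<le>m. bst_avg j F) = (real m + 2) * (real m + 3) / 2 * c m"
      unfolding Suc.IH by (simp add: field_simps)
    also have "bst_avg (Suc m) f =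
        (real m + 2) * (real m + 3) / 2 * (2 * bst_avg (Suc m) f / ((real m + 2) * (real m + 3)))"
      by (simp del: bst_avg.simps)
    also have "(real m + 2) * (real m + 3) / 2 * c m + \<dots> = (real m + 2) * (real m + 3) / 2 * c (Suc m)"
      unfolding c by (rule distrib_left[symmetric])
    finally show ?case by (simp add: add_ac)
  qed
  obtain m where n: "n = Suc m" using \<open>n > 0\<close> by (cases n) auto
  show ?thesis
    unfolding n rec S by (simp add: field_simps c_def del: bst_avg.simps)
qed

text \<open>For a toll depending on the sizes alone, the fluctuations generated at different vertices are
  orthogonal, and each of them is bounded because the mean is linear up to a bounded error.\<close>

lemma bst_avg_variance:
  fixes f :: "unit tree \<Rightarrow> real" and h :: "nat \<Rightarrow> nat \<Rightarrow> real"
  assumes f: "\<And>l r. f (Node l () r) = h (size l) (size r)" and C: "\<And>i j. \<bar>h i j\<bar> \<le> C"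
    and B: "\<And>n. \<bar>bst_avg n (fringe_sum f) - \<alpha> * (real n + 1)\<bar> \<le> B"
  shows "bst_avg n (\<lambda>t. (fringe_sum f t - bst_avg n (fringe_sum f))\<^sup>2) \<le> (C + 3 * B)\<^sup>2 * real n"
proof (induction n rule: less_induct)
  case (less n)
  define \<mu> where "\<mu> n = bst_avg n (fringe_sum f)" for n
  define V where "V n = bst_avg n (\<lambda>t. (fringe_sum f t - \<mu> n)\<^sup>2)" for n
  have zero: "bst_avg n (\<lambda>t. fringe_sum f t - \<mu> n) = 0" for n
    by (simp add: bst_avg_diff \<mu>_def)
  show ?case
  proof (cases n)
    case (Suc m)
    define d where "d j = h j (m - j) + \<mu> j + \<mu> (m - j) - \<mu> (Suc m)" for j
    have d: "(d j)\<^sup>2 \<le> (C + 3 * B)\<^sup>2" if "j \<le> m" for j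
    proof -
      \<comment> \<open>Size plus one, the number of empty positions, is exactly additive over the
        two subtrees. Hence the linear parts of the three means cancel and only the toll and three
        errors remain, which gives \<open>C + 3 * B\<close>.\<close>
      have "\<alpha> * (real j + 1) + \<alpha> * (real (m - j) + 1) = \<alpha> * (real (Suc m) + 1)"
        using that by (simp add: algebra_simps of_nat_diff)
      then have "\<bar>d j\<bar> \<le> C + 3 * B"
        using C[of j "m - j"] B[of j] B[of "m - j"] B[of "Suc m"] unfolding d_def \<mu>_def by linarith
      then show ?thesis using power_mono[of "\<bar>d j\<bar>" "C + 3 * B" 2] by simp
    qed
    \<comment> \<open>Given the left size, the deviation is \<open>d j\<close> plus the centred
      deviations of both subtrees. Every cross term is linear in a centred deviation and vanishes
      under the inner or the outer average.\<close>
    have "V (Suc m) = (\<Sum>j\<le>m. (d j)\<^sup>2 + V j + V (m - j)) / real (Suc m)"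
    proof -
      have "bst_avg j (\<lambda>l. bst_avg (m - j) (\<lambda>r. (fringe_sum f (Node l () r) - \<mu> (Suc m))\<^sup>2)) =
          (d j)\<^sup>2 + V j + V (m - j)" if "j \<le> m" for j
      proof -
        have "bst_avg (m - j) (\<lambda>r. (fringe_sum f (Node l () r) - \<mu> (Suc m))\<^sup>2) =
          (d j)\<^sup>2 + (2 * d j) * (fringe_sum f l - \<mu> j) + (fringe_sum f l - \<mu> j)\<^sup>2 + V (m - j)"
          if "size l = j" for l
        proof -
          have "bst_avg (m - j) (\<lambda>r. (fringe_sum f (Node l () r) - \<mu> (Suc m))\<^sup>2) =
            bst_avg (m - j) (\<lambda>r. ((d j)\<^sup>2 + (2 * d j) * (fringe_sum f l - \<mu> j) + (fringe_sum f l - \<mu> j)\<^sup>2)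
              + (2 * d j + 2 * (fringe_sum f l - \<mu> j)) * (fringe_sum f r - \<mu> (m - j))
              + (fringe_sum f r - \<mu> (m - j))\<^sup>2)"
            using that by (intro bst_avg_cong) (simp add: f d_def power2_eq_square algebra_simps)
          also have "\<dots> = (d j)\<^sup>2 + (2 * d j) * (fringe_sum f l - \<mu> j) + (fringe_sum f l - \<mu> j)\<^sup>2 + V (m - j)"
            unfolding bst_avg_add bst_avg_cmult zero bst_avg_const V_def by simp
          finally show ?thesis .
        qed
        then have "bst_avg j (\<lambda>l. bst_avg (m - j) (\<lambda>r. (fringe_sum f (Node l () r) - \<mu> (Suc m))\<^sup>2)) =
          bst_avg j (\<lambda>l. (d j)\<^sup>2 + (2 * d j) * (fringe_sum f l - \<mu> j) + (fringe_sum f l - \<mu> j)\<^sup>2 + V (m - j))"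
          by (intro bst_avg_cong)
        also have "\<dots> = (d j)\<^sup>2 + V j + V (m - j)"
          unfolding bst_avg_add bst_avg_cmult zero bst_avg_const V_def by simp
        finally show ?thesis .
      qed
      then show ?thesis unfolding V_def[of "Suc m"] by (simp del: fringe_sum.simps)
    qed
    also have "\<dots> \<le> (\<Sum>j\<le>m. (C + 3 * B)\<^sup>2 + (C + 3 * B)\<^sup>2 * real j + (C + 3 * B)\<^sup>2 * real (m - j)) / real (Suc m)"
    proof (intro divide_right_mono sum_mono add_mono d)
      show "V j \<le> (C + 3 * B)\<^sup>2 * real j" "V (m - j) \<le> (C + 3 * B)\<^sup>2 * real (m - j)" if "j \<in> {..m}" for j
        using less.IH[of j] less.IH[of "m - j"] that Suc by (auto simp: V_def \<mu>_def)
    qed auto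
    also have "\<dots> = (\<Sum>j\<le>m. (C + 3 * B)\<^sup>2 * real (Suc m)) / real (Suc m)"
      by (intro arg_cong2[where f = "(/)"] sum.cong) (auto simp: algebra_simps of_nat_diff)
    also have "\<dots> = (C + 3 * B)\<^sup>2 * real n" by (simp add: Suc)
    finally show ?thesis by (simp only: V_def \<mu>_def Suc)
  qed simp
qed

text \<open>A pointwise substitute for the Cauchy-Schwarz inequality: with \<open>s\<close> of order
  sqrt n, a second moment of order n yields a first absolute moment of order sqrt n.\<close>

lemma abs_le_mean_square:
  fixes x s :: real
  assumes "s > 0"
  shows "\<bar>x\<bar> \<le> (x\<^sup>2 / s + s) / 2"
proof -
  have "0 \<le> (\<bar>x\<bar> - s)\<^sup>2" by simp
  then show ?thesis using assms by (simp add: power2_eq_square field_simps abs_mult_self_eq)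
qed

section \<open>Counting plane shapes\<close>

lemma fringe_subtrees_simps [simp]:
  "fringe_subtrees Leaf = {}"
  "fringe_subtrees (Node l a r) = insert (Node l a r) (fringe_subtrees l \<union> fringe_subtrees r)"
  by (auto simp: fringe_subtrees_def)

lemma finite_fringe_subtrees [simp]: "finite (fringe_subtrees t)"
  by (induction t) auto

lemma plane_shape_map_tree: "t \<noteq> Leaf \<Longrightarrow> plane_shape (map_tree f t) = plane_shape t"
  by (induction t) auto

lemma fringe_subtrees_map_tree: "fringe_subtrees (map_tree f t) = map_tree f ` fringe_subtrees t"
  by (induction t) (auto simp: image_Un)

lemma num_plane_fringe_shapes_map_tree:
  "num_plane_fringe_shapes (map_tree f t) = num_plane_fringe_shapes t"
proof -
  \<comment> \<open>The unspecified shape of \<open>Leaf\<close> may depend on the type of the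
    labels, so it must not occur.\<close>
  have "Leaf \<notin> fringe_subtrees t" by (simp add: fringe_subtrees_def)
  then have "plane_shape ` fringe_subtrees (map_tree f t) = plane_shape ` fringe_subtrees t"
    unfolding fringe_subtrees_map_tree image_image
    by (intro image_cong refl plane_shape_map_tree) auto
  then show ?thesis by (simp add: num_plane_fringe_shapes_def)
qed

section \<open>Unary-binary plane trees and their number\<close>

primrec plane_size :: "plane_tree \<Rightarrow> nat" where
  "plane_size (Plane_Node ts) = Suc (sum_list (map plane_size ts))"

lemma plane_size_plane_shape: "t \<noteq> Leaf \<Longrightarrow> plane_size (plane_shape t) = size t"
  by (induction t) auto

lemma fringe_subtrees_size: "s \<in> fringe_subtrees t \<Longrightarrow> s \<noteq> Leaf \<and> size s \<le> size t"
  by (induction t) auto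

lemma card_fringe_subtrees_le:
  "real (card {s \<in> fringe_subtrees t. P s}) \<le> fringe_sum (\<lambda>s. of_bool (P s)) t"
proof (induction t)
  case (Node l a r)
  have "{s \<in> fringe_subtrees (Node l a r). P s} \<subseteq>
      {s. s = Node l a r \<and> P s} \<union> ({s \<in> fringe_subtrees l. P s} \<union> {s \<in> fringe_subtrees r. P s})"
    by auto
  then have "card {s \<in> fringe_subtrees (Node l a r). P s} \<le>
      card ({s. s = Node l a r \<and> P s} \<union> ({s \<in> fringe_subtrees l. P s} \<union> {s \<in> fringe_subtrees r. P s}))"
    by (intro card_mono) auto
  also have "\<dots> \<le> card {s. s = Node l a r \<and> P s} +
      (card {s \<in> fringe_subtrees l. P s} + card {s \<in> fringe_subtrees r. P s})"
    by (intro order_trans[OF card_Un_le] add_left_mono card_Un_le)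
  also have "card {s. s = Node l a r \<and> P s} = of_bool (P (Node l a r))"
    by (cases "P (Node l a r)") (auto simp: Collect_conv_if)
  finally have "real (card {s \<in> fringe_subtrees (Node l a r). P s}) \<le> real (of_bool (P (Node l a r)) +
      (card {s \<in> fringe_subtrees l. P s} + card {s \<in> fringe_subtrees r. P s}))"
    by (rule of_nat_mono)
  then show ?case using Node.IH by (simp del: fringe_subtrees_simps)
qed simp

lemma fringe_sum_one: "fringe_sum (\<lambda>_. 1) t = real (size t)"
  by (induction t) auto

text \<open>Cut off by height rather than size: the sets are finite and each arises from the
  previous one by a single application of the grammar, so weighted sums over them can be bounded by
  induction.\<close>

fun unary_binary_trees :: "nat \<Rightarrow> plane_tree set" where
  "unary_binary_trees 0 = {}"
| "unary_binary_trees (Suc h) = {Plane_Node []} \<union> (\<lambda>a. Plane_Node [a]) ` unary_binary_trees h \<union>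
     (\<lambda>(a, b). Plane_Node [a, b]) ` (unary_binary_trees h \<times> unary_binary_trees h)"

lemma finite_unary_binary_trees [simp]: "finite (unary_binary_trees h)"
  by (induction h) auto

lemma plane_shape_in_unary_binary_trees:
  "t \<noteq> Leaf \<Longrightarrow> size t \<le> h \<Longrightarrow> plane_shape t \<in> unary_binary_trees h"
proof (induction t arbitrary: h)
  case (Node l a r)
  then obtain h' where "h = Suc h'" by (cases h) auto
  then show ?case using Node by (cases "l = Leaf"; cases "r = Leaf") auto
qed simp

text \<open>For \<open>x = 1/3\<close>, the dominant singularity of the Motzkin generating function, the equation
  \<open>y = x (1 + y + y\<^sup>2)\<close> has the fixed point \<open>y = 1\<close>.\<close>

lemma sum_unary_binary_trees_le: "(\<Sum>S\<in>unary_binary_trees h. (1/3::real) ^ plane_size S) \<le> 1"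
proof (induction h)
  case (Suc h)
  define T where "T = unary_binary_trees h"
  define y where "y = (\<Sum>S\<in>T. (1/3::real) ^ plane_size S)"
  have y: "0 \<le> y" "y \<le> 1" using Suc by (auto simp: y_def T_def intro: sum_nonneg)
  have T: "finite T" by (simp add: T_def)
  have "(\<Sum>S\<in>unary_binary_trees (Suc h). (1/3::real) ^ plane_size S) =
      1/3 + (\<Sum>S\<in>(\<lambda>a. Plane_Node [a]) ` T. (1/3) ^ plane_size S)
          + (\<Sum>S\<in>(\<lambda>(a, b). Plane_Node [a, b]) ` (T \<times> T). (1/3) ^ plane_size S)"
    unfolding unary_binary_trees.simps T_def[symmetric] using T
    by (subst sum.union_disjoint; (subst sum.union_disjoint)?) auto
  also have "(\<Sum>S\<in>(\<lambda>a. Plane_Node [a]) ` T. (1/3::real) ^ plane_size S) = y / 3"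
    by (subst sum.reindex) (auto simp: inj_on_def y_def sum_divide_distrib)
  also have "(\<Sum>S\<in>(\<lambda>(a, b). Plane_Node [a, b]) ` (T \<times> T). (1/3::real) ^ plane_size S) =
      (\<Sum>(a, b)\<in>T \<times> T. (1/3) ^ plane_size a * (1/3) ^ plane_size b) / 3"
    by (subst sum.reindex)
       (auto simp: inj_on_def sum_divide_distrib case_prod_unfold power_add intro!: sum.cong)
  also have "(\<Sum>(a, b)\<in>T \<times> T. (1/3::real) ^ plane_size a * (1/3) ^ plane_size b) = y * y"
    unfolding y_def sum_product sum.cartesian_product ..
  also have "1/3 + y / 3 + y * y / 3 \<le> 1"
    using y mult_mono[of y 1 y 1] by simp
  finally show ?case .
qed simp

text \<open>A Kraft type argument: each tree counted has weight at least \<open>(1/3) ^ k\<close> in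
  a sum that is at most 1.\<close>

lemma card_plane_trees_le: "real (card {S \<in> unary_binary_trees k. plane_size S \<le> k}) \<le> 3 ^ k"
proof -
  have "real (card {S \<in> unary_binary_trees k. plane_size S \<le> k}) * (1/3) ^ k =
      (\<Sum>S\<in>{S \<in> unary_binary_trees k. plane_size S \<le> k}. (1/3) ^ k)"
    by simp
  also have "\<dots> \<le> (\<Sum>S\<in>{S \<in> unary_binary_trees k. plane_size S \<le> k}. (1/3) ^ plane_size S)"
    by (intro sum_mono power_decreasing) auto
  also have "\<dots> \<le> (\<Sum>S\<in>unary_binary_trees k. (1/3) ^ plane_size S)"
    by (intro sum_mono2) auto
  also have "\<dots> \<le> 1" by (rule sum_unary_binary_trees_le)
  finally show ?thesis by (simp add: power_one_over field_simps)
qed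

abbreviation num_large :: "nat \<Rightarrow> 'a tree \<Rightarrow> real" where
  "num_large k \<equiv> fringe_sum (\<lambda>t. of_bool (k \<le> size t))"

lemma num_plane_fringe_shapes_le: "real (num_plane_fringe_shapes t) \<le> 3 ^ k + num_large k t"
proof -
  have "plane_shape ` fringe_subtrees t \<subseteq> {S \<in> unary_binary_trees k. plane_size S \<le> k} \<union>
      plane_shape ` {s \<in> fringe_subtrees t. k \<le> size s}"
  proof
    fix S assume "S \<in> plane_shape ` fringe_subtrees t"
    then obtain s where s: "s \<in> fringe_subtrees t" "S = plane_shape s" by auto
    then show "S \<in> {S \<in> unary_binary_trees k. plane_size S \<le> k} \<union>
        plane_shape ` {s \<in> fringe_subtrees t. k \<le> size s}"
      using fringe_subtrees_size[OF s(1)]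
      by (cases "k \<le> size s") (auto simp: plane_shape_in_unary_binary_trees plane_size_plane_shape)
  qed
  then have "num_plane_fringe_shapes t \<le> card ({S \<in> unary_binary_trees k. plane_size S \<le> k} \<union>
      plane_shape ` {s \<in> fringe_subtrees t. k \<le> size s})"
    unfolding num_plane_fringe_shapes_def by (intro card_mono) auto
  also have "\<dots> \<le> card {S \<in> unary_binary_trees k. plane_size S \<le> k} +
      card {s \<in> fringe_subtrees t. k \<le> size s}"
    by (intro order_trans[OF card_Un_le] add_left_mono card_image_le) auto
  finally show ?thesis
    using card_plane_trees_le[of k] card_fringe_subtrees_le[of t "\<lambda>s. k \<le> size s"] by linarith
qed

section \<open>Repeated shapes\<close>

definition fringe_shapes :: "(plane_tree \<Rightarrow> bool) \<Rightarrow> 'a tree \<Rightarrow> plane_tree set" where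
  "fringe_shapes good t = {S \<in> plane_shape ` fringe_subtrees t. good S}"

lemma fringe_shapes_simps [simp]:
  "fringe_shapes good Leaf = {}"
  "fringe_shapes good (Node l a r) = (if good (plane_shape (Node l a r)) then {plane_shape (Node l a r)} else {})
     \<union> (fringe_shapes good l \<union> fringe_shapes good r)"
  by (auto simp: fringe_shapes_def)

lemma finite_fringe_shapes [simp]: "finite (fringe_shapes good t)"
  by (simp add: fringe_shapes_def)

lemma plane_size_fringe_shapes: "S \<in> fringe_shapes good t \<Longrightarrow> plane_size S \<le> size t"
  using fringe_subtrees_size[of _ t] by (auto simp: fringe_shapes_def plane_size_plane_shape)

lemma card_fringe_shapes_le: "card (fringe_shapes good t) \<le> num_plane_fringe_shapes t"
  unfolding fringe_shapes_def num_plane_fringe_shapes_def by (intro card_mono) auto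

lemma card_fringe_shapes_le_size: "real (card (fringe_shapes good t)) \<le> real (size t)"
proof -
  have "card (fringe_shapes good t) \<le> card (plane_shape ` fringe_subtrees t)"
    unfolding fringe_shapes_def by (intro card_mono) auto
  also have "\<dots> \<le> card (fringe_subtrees t)" by (intro card_image_le) simp
  finally show ?thesis
    using card_fringe_subtrees_le[of t "\<lambda>_. True"] by (simp add: fringe_sum_one)
qed

text \<open>A good shape carried by r vertices contributes r - 1.\<close>

definition shape_excess :: "(plane_tree \<Rightarrow> bool) \<Rightarrow> 'a tree \<Rightarrow> real" where
  "shape_excess good t =
     fringe_sum (\<lambda>s. of_bool (good (plane_shape s))) t - real (card (fringe_shapes good t))"

text \<open>The shape at the root is larger than all others and repeats nothing, so new repetitions
  come only from shapes common to both sides. This makes the excess an additive functional whose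
  toll compares two independent subtrees.\<close>

lemma shape_excess_Node:
  "shape_excess good (Node l a r) = real (card (fringe_shapes good l \<inter> fringe_shapes good r))
     + shape_excess good l + shape_excess good r"
proof -
  let ?S = "plane_shape (Node l a r)" and ?D = "fringe_shapes good"
  have "?S \<notin> ?D l \<union> ?D r"
    using plane_size_fringe_shapes[of ?S good l] plane_size_fringe_shapes[of ?S good r]
      plane_size_plane_shape[of "Node l a r"] by auto
  then have "card (?D (Node l a r)) = of_bool (good ?S) + card (?D l \<union> ?D r)"
    by (cases "good ?S") (auto simp del: plane_shape.simps)
  moreover have "card (?D l) + card (?D r) = card (?D l \<union> ?D r) + card (?D l \<inter> ?D r)"
    by (intro card_Un_Int) auto
  ultimately show ?thesis
    by (simp add: shape_excess_def del: plane_shape.simps fringe_shapes_simps)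
qed

lemma shape_excess_nonneg: "0 \<le> shape_excess good t"
  by (induction t) (auto simp: shape_excess_Node, simp add: shape_excess_def)

lemma sum_squares_atMost: "(\<Sum>j\<le>m. (real j)\<^sup>2) = real m * (real m + 1) * (2 * real m + 1) / 6"
  by (induction m) (auto simp: field_simps power2_eq_square)

text \<open>With the left subtree fixed, it offers at most \<open>j\<close> good shapes, and each is
  expected at most \<open>p * (m - j)\<close> times on the right, by the linear bound for additive
  functionals. The toll is therefore at most \<open>p * (m + 1)^2\<close> on average.\<close>

lemma bst_avg_shape_excess_le:
  assumes p: "p \<ge> 0"
    and good: "\<And>S m. good S \<Longrightarrow> bst_avg (Suc m) (\<lambda>t. of_bool (plane_shape t = S)) \<le> p"
  shows "bst_avg n (shape_excess good) \<le> 3 * p * (real n)\<^sup>2"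
proof -
  let ?D = "fringe_shapes good :: unit tree \<Rightarrow> _"
  let ?N = "\<lambda>S. fringe_sum (\<lambda>t. of_bool (plane_shape t = S)) :: unit tree \<Rightarrow> real"
  have N: "bst_avg n (?N S) \<le> p * real n" if "good S" for S n
    by (rule bst_avg_additive_linear[where f = "\<lambda>t. of_bool (plane_shape t = S)"])
       (use good[OF that] in auto)
  have inter: "real (card (?D l \<inter> ?D r)) \<le> (\<Sum>S\<in>?D l. ?N S r)" for l r
  proof -
    have "real (card (?D l \<inter> ?D r)) = (\<Sum>S\<in>?D l. of_bool (S \<in> ?D r))"
      by (simp add: sum_of_bool_eq Int_def)
    also have "\<dots> \<le> (\<Sum>S\<in>?D l. ?N S r)"
    proof (intro sum_mono)
      fix S
      show "of_bool (S \<in> ?D r) \<le> ?N S r"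
      proof (cases "S \<in> ?D r")
        case True
        then have "{s \<in> fringe_subtrees r. plane_shape s = S} \<noteq> {}"
          by (auto simp: fringe_shapes_def)
        then have "card {s \<in> fringe_subtrees r. plane_shape s = S} \<ge> 1"
          by (simp add: Suc_le_eq card_gt_0_iff)
        then show ?thesis using card_fringe_subtrees_le[of r "\<lambda>s. plane_shape s = S"] by simp
      qed (auto intro: fringe_sum_nonneg)
    qed
    finally show ?thesis .
  qed
  define f :: "unit tree \<Rightarrow> real" where
    "f t = (case t of Leaf \<Rightarrow> 0 | Node l _ r \<Rightarrow> real (card (?D l \<inter> ?D r)))" for t
  have toll: "bst_avg (Suc m) f \<le> p * (real (Suc m))\<^sup>2" for m
  proof -
    have "bst_avg j (\<lambda>l. bst_avg (m - j) (\<lambda>r. f (Node l () r))) \<le> p * (real (Suc m))\<^sup>2"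
      if "j \<le> m" for j
    proof -
      have "bst_avg (m - j) (\<lambda>r. f (Node l () r)) \<le> p * (real (Suc m))\<^sup>2" if "size l = j" for l
      proof -
        have "bst_avg (m - j) (\<lambda>r. f (Node l () r)) \<le> bst_avg (m - j) (\<lambda>r. \<Sum>S\<in>?D l. ?N S r)"
          using inter by (intro bst_avg_mono) (simp add: f_def)
        also have "\<dots> = (\<Sum>S\<in>?D l. bst_avg (m - j) (?N S))" by (rule bst_avg_sum)
        also have "\<dots> \<le> (\<Sum>S\<in>?D l. p * real (m - j))"
          by (intro sum_mono N) (simp add: fringe_shapes_def)
        also have "\<dots> = real (card (?D l)) * (p * real (m - j))" by simp
        also have "\<dots> \<le> real j * (p * real (m - j))"
          using card_fringe_shapes_le_size[of good l] that p by (intro mult_right_mono) auto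
        also have "\<dots> \<le> real (Suc m) * (p * real (Suc m))"
          using p \<open>j \<le> m\<close> by (intro mult_mono) auto
        finally show ?thesis by (simp add: power2_eq_square mult_ac)
      qed
      then have "bst_avg j (\<lambda>l. bst_avg (m - j) (\<lambda>r. f (Node l () r))) \<le> bst_avg j (\<lambda>_. p * (real (Suc m))\<^sup>2)"
        by (intro bst_avg_mono)
      then show ?thesis by (simp only: bst_avg_const)
    qed
    then have "(\<Sum>j\<le>m. bst_avg j (\<lambda>l. bst_avg (m - j) (\<lambda>r. f (Node l () r)))) \<le> (\<Sum>j\<le>m. p * (real (Suc m))\<^sup>2)"
      by (intro sum_mono) auto
    then show ?thesis by (simp add: divide_le_eq mult.commute del: of_nat_Suc)
  qed
  show ?thesis
  proof (rule bst_avg_additive_le[of _ f])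
    show "shape_excess good (Node l () r) = f (Node l () r) + shape_excess good l + shape_excess good r" for l r
      by (simp add: shape_excess_Node f_def)
    show "shape_excess good Leaf \<le> 3 * p * (real 0)\<^sup>2" by (simp add: shape_excess_def)
  next
    fix m
    \<comment> \<open>The recurrence returns two thirds of a quadratic bound, so a toll of
      \<open>p\<close> times the square is absorbed by the constant 3 = 1 + 2.\<close>
    have "2 / real (Suc m) * (\<Sum>j\<le>m. 3 * p * (real j)\<^sup>2) = p * (real m * (2 * real m + 1))"
      unfolding sum_distrib_left[symmetric] sum_squares_atMost by (simp add: field_simps)
    moreover have "p * (real m * (2 * real m + 1)) \<le> p * (2 * (real (Suc m))\<^sup>2)"
      using p by (intro mult_left_mono) (auto simp: power2_eq_square algebra_simps)
    ultimately show "bst_avg (Suc m) f + 2 / real (Suc m) * (\<Sum>j\<le>m. 3 * p * (real j)\<^sup>2) \<le> 3 * p * (real (Suc m))\<^sup>2"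
      using toll[of m] by linarith
  qed
qed

section \<open>The entropy of a random plane shape\<close>

lemma bst_avg_size: "bst_avg n (\<lambda>t. g (size t)) = g n"
proof -
  have "bst_avg n (\<lambda>t. g (size t)) = bst_avg n (\<lambda>_. g n)" by (intro bst_avg_cong) simp
  then show ?thesis by simp
qed

text \<open>The weights telescope from \<open>k\<close> to \<open>n - 1\<close> and give
  \<open>2 * (n + 1) / (k + 1) - 2\<close>; the root itself adds 1.\<close>

lemma bst_avg_num_large:
  assumes "k > 0"
  shows "bst_avg n (num_large k) = (if n < k then 0 else 2 * (real n + 1) / (real k + 1) - 1)"
proof (cases "n = 0")
  case False
  have a: "bst_avg i (\<lambda>t. of_bool (k \<le> size t)) = of_bool (k \<le> i)" for i
    by (rule bst_avg_size)
  have mean: "bst_avg n (num_large k) =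
      (real n + 1) * (\<Sum>i=1..<n. 2 * of_bool (k \<le> i) / ((real i + 1) * (real i + 2))) + of_bool (k \<le> n)"
    using bst_avg_additive_closed_form[of "num_large k" "\<lambda>t. of_bool (k \<le> size t)" n] False
    unfolding a by (simp del: bst_avg.simps)
  show ?thesis
  proof (cases "n < k")
    case True
    then show ?thesis unfolding mean by simp
  next
    case False
    then have "k \<le> n" by simp
    then have "(\<Sum>i=1..<n. 2 * of_bool (k \<le> i) / ((real i + 1) * (real i + 2))) =
        2 / (real k + 1) - 2 / (real n + 1)"
    proof (induction n rule: dec_induct)
      case (step n)
      have "(\<Sum>i=1..<Suc n. 2 * of_bool (k \<le> i) / ((real i + 1) * (real i + 2))) =
          2 / (real k + 1) - 2 / (real n + 1) + 2 / ((real n + 1) * (real n + 2))"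
        using step assms by simp
      also have "2 / ((real n + 1) * (real n + 2)) = 2 / (real n + 1) - 2 / (real (Suc n) + 1)"
        by (simp add: field_simps)
      finally show ?case by simp
    qed auto
    moreover have "(real n + 1) * (2 / (real k + 1) - 2 / (real n + 1)) =
        2 * (real n + 1) / (real k + 1) - 2 * (real n + 1) / (real n + 1)"
      by (simp only: right_diff_distrib times_divide_eq_right mult.commute)
    moreover have "2 * (real n + 1) / (real n + 1) = 2" by (rule nonzero_mult_div_cancel_right) simp
    ultimately show ?thesis using False unfolding mean by simp
  qed
qed (use assms in simp)

lemma bst_avg_num_large_le: "k > 0 \<Longrightarrow> bst_avg n (num_large k) \<le> 2 * (real n + 1) / (real k + 1)"
  by (simp add: bst_avg_num_large)

lemma bst_avg_abs_le:
  assumes "bst_avg n (\<lambda>t. (g t)\<^sup>2) \<le> c * real n" "n > 0"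
  shows "bst_avg n (\<lambda>t. \<bar>g t\<bar>) \<le> (c + 1) / 2 * sqrt (real n)"
proof -
  define s where "s = sqrt (real n)"
  have s: "s > 0" "s * s = real n" using assms by (auto simp: s_def)
  have "bst_avg n (\<lambda>t. \<bar>g t\<bar>) \<le> bst_avg n (\<lambda>t. inverse (2 * s) * (g t)\<^sup>2 + s / 2)"
    using abs_le_mean_square[OF s(1)] by (intro bst_avg_mono) (simp add: field_simps)
  also have "\<dots> = inverse (2 * s) * bst_avg n (\<lambda>t. (g t)\<^sup>2) + s / 2"
    unfolding bst_avg_add bst_avg_cmult bst_avg_const ..
  also have "\<dots> \<le> inverse (2 * s) * (c * (s * s)) + s / 2"
    using assms s by (intro add_right_mono mult_left_mono) auto
  also have "\<dots> = (c + 1) / 2 * s" using s(1) by (simp add: field_simps)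
  finally show ?thesis by (simp add: s_def)
qed

text \<open>The toll is at most 1 and the mean is within 2 of a multiple of \<open>n + 1\<close>, so
  the variance is at most 49 n, and 25 = (49 + 1) / 2. Uniformity in \<open>k\<close> matters, since
  \<open>k\<close> will grow with \<open>n\<close>.\<close>

lemma bst_avg_abs_num_large:
  assumes "k > 0" "n > 0"
  shows "bst_avg n (\<lambda>t. \<bar>num_large k t - bst_avg n (num_large k)\<bar>) \<le> 25 * sqrt (real n)"
proof -
  have "bst_avg n (\<lambda>t. (num_large k t - bst_avg n (num_large k))\<^sup>2) \<le> (1 + 3 * 2)\<^sup>2 * real n"
  proof (rule bst_avg_variance[where h = "\<lambda>i j. of_bool (k \<le> Suc (i + j))" and \<alpha> = "2 / (real k + 1)"])
    fix n
    have "2 / (real k + 1) * (real n + 1) \<le> 2" if "n < k"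
      using that by (simp add: field_simps)
    then show "\<bar>bst_avg n (num_large k) - 2 / (real k + 1) * (real n + 1)\<bar> \<le> 2"
      using assms by (auto simp: bst_avg_num_large)
  qed auto
  then show ?thesis using bst_avg_abs_le[OF _ assms(2), of _ 49] by simp
qed

text \<open>The negative logarithm of the probability of a split: the left size is uniform among
  \<open>i + j + 1\<close> values, and an only child may sit on either side, which doubles the
  probability. It depends on the two sizes alone, as the variance bound requires.\<close>

definition entropy_toll :: "nat \<Rightarrow> nat \<Rightarrow> nat \<Rightarrow> real" where
  "entropy_toll K i j = (if i + j + 1 \<le> K
     then ln (real (i + j + 1)) - (if (i = 0) \<noteq> (j = 0) then ln 2 else 0) else 0)"

definition entropy_node :: "nat \<Rightarrow> 'a tree \<Rightarrow> real" where
  "entropy_node K t = (case t of Leaf \<Rightarrow> 0 | Node l _ r \<Rightarrow> entropy_toll K (size l) (size r))"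

abbreviation entropy :: "nat \<Rightarrow> 'a tree \<Rightarrow> real" where
  "entropy K \<equiv> fringe_sum (entropy_node K)"

lemma entropy_node_Node [simp]: "entropy_node K (Node l a r) = entropy_toll K (size l) (size r)"
  by (simp add: entropy_node_def)

lemma entropy_toll_bounds: "0 \<le> entropy_toll K i j" "entropy_toll K i j \<le> ln (real K + 1)"
proof -
  have "ln 2 \<le> ln (real (i + j + 1))" if "(i = 0) \<noteq> (j = 0)" using that by auto
  then show "0 \<le> entropy_toll K i j" by (auto simp: entropy_toll_def)
  have "ln (real (i + j + 1)) \<le> ln (real K + 1)" if "i + j + 1 \<le> K" using that by simp
  moreover have "(0::real) \<le> ln 2" "0 \<le> ln (real K + 1)" by auto
  ultimately show "entropy_toll K i j \<le> ln (real K + 1)"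
    unfolding entropy_toll_def by (smt (verit))
qed

lemma bst_avg_is_Leaf: "bst_avg n (\<lambda>t. of_bool (t = Leaf)) = of_bool (n = 0)"
  using bst_avg_size[of n "\<lambda>k. of_bool (k = 0)"] by simp

text \<open>A random tree of size \<open>n\<close> has a given plane shape with probability
  \<open>2\<^sup>u / (\<Prod>v. |T\<^sub>v|)\<close>, where \<open>u\<close> is the number of vertices with exactly one child; truncating the
  tolls at size \<open>K\<close> only enlarges the bound.\<close>

lemma bst_avg_plane_shape_le:
  fixes t :: "unit tree"
  assumes "t \<noteq> Leaf"
  shows "bst_avg n (\<lambda>s. of_bool (s \<noteq> Leaf \<and> plane_shape s = plane_shape t)) \<le> exp (- entropy K t)"
  using assms
proof (induction t arbitrary: n)
  case (Node l a r)
  let ?u = "\<lambda>(c :: unit tree) (s :: unit tree). of_bool (s \<noteq> Leaf \<and> plane_shape s = plane_shape c) :: real"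
  let ?t = "Node l a r"
  have size_eq: "size s = size c" if "s \<noteq> Leaf" "c \<noteq> Leaf" "plane_shape s = plane_shape c"
    for s c :: "unit tree"
    using that plane_size_plane_shape[of s] plane_size_plane_shape[of c] by simp
  \<comment> \<open>Equal shapes have equal sizes. This disposes of all \<open>n\<close> but one
    and, at a binary vertex, of all left sizes but one.\<close>
  have u_zero: "bst_avg i (?u c) = 0" if "i \<noteq> size c" "c \<noteq> Leaf" for i and c :: "unit tree"
  proof -
    have "bst_avg i (?u c) = bst_avg i (\<lambda>_. 0)"
    proof (rule bst_avg_cong)
      fix s :: "unit tree" assume "size s = i"
      then have "\<not> (s \<noteq> Leaf \<and> plane_shape s = plane_shape c)" using size_eq[of s c] that by blast
      then show "?u c s = 0" by (simp only: of_bool_eq)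
    qed
    then show ?thesis by (simp only: bst_avg_const)
  qed
  show ?case
  proof (cases "n = size ?t")
    case False
    then show ?thesis using u_zero[of n ?t] by simp
  next
    case True
    define m where "m = size l + size r"
    have n: "n = Suc m" using True by (simp add: m_def)
    let ?A = "\<lambda>j. bst_avg j (\<lambda>l'. bst_avg (m - j) (\<lambda>r'. ?u ?t (Node l' () r')))"
    have avg: "bst_avg n (?u ?t) = (\<Sum>j\<le>m. ?A j) / real (Suc m)" unfolding n by simp
    \<comment> \<open>Beyond \<open>K\<close> the left side is 1, and the numerator 2 is harmless
      because a unary vertex has \<open>m > 0\<close>.\<close>
    have toll: "exp (- entropy_toll K (size l) (size r)) \<ge> (if (l = Leaf) \<noteq> (r = Leaf) then 2 else 1) / real (Suc m)"
    proof (cases "Suc m \<le> K")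
      case True
      then show ?thesis
        by (auto simp: entropy_toll_def m_def exp_diff exp_minus ln_div field_simps)
    next
      case False
      then show ?thesis by (cases "l = Leaf"; cases "r = Leaf")
          (auto simp: entropy_toll_def m_def field_simps Suc_le_eq zero_less_iff_neq_zero simp del: neq0_conv)
    qed
    \<comment> \<open>Both one-child cases at once: the child \<open>c\<close> may be matched on the
      left (\<open>j = m\<close>) or on the right (\<open>j = 0\<close>), so two of the
      \<open>m + 1\<close> left sizes contribute.\<close>
    have unary: ?thesis if c: "c \<noteq> Leaf" "plane_shape ?t = Plane_Node [plane_shape c]"
      and IH: "\<And>n. bst_avg n (?u c) \<le> exp (- entropy K c)"
      and eq: "(l = Leaf) \<noteq> (r = Leaf)" "entropy K l + entropy K r = entropy K c" for c
    proof -
      define E where "E = exp (- entropy K c)"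
      have "?A j \<le> of_bool (j = m) * E + of_bool (j = 0) * E" if "j \<le> m" for j
      proof -
        have "?A j \<le> bst_avg j (\<lambda>l'. bst_avg (m - j) (\<lambda>r'.
            ?u c l' * of_bool (r' = Leaf) + of_bool (l' = Leaf) * ?u c r'))"
          unfolding c(2) by (intro bst_avg_mono) auto
        also have "\<dots> = of_bool (m - j = 0) * bst_avg j (?u c) + of_bool (j = 0) * bst_avg (m - j) (?u c)"
          unfolding bst_avg_add bst_avg_cmult bst_avg_multc bst_avg_is_Leaf by (simp only: mult.commute)
        also have "\<dots> \<le> of_bool (m - j = 0) * E + of_bool (j = 0) * E"
          using IH unfolding E_def by (intro add_mono mult_left_mono) auto
        also have "of_bool (m - j = 0) = (of_bool (j = m) :: real)" using that by auto
        finally show ?thesis .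
      qed
      then have "(\<Sum>j\<le>m. ?A j) \<le> (\<Sum>j\<le>m. of_bool (j = m) * E + of_bool (j = 0) * E)"
        by (intro sum_mono) auto
      also have "\<dots> = 2 * E"
        by (simp add: sum.distrib sum_distrib_right[symmetric] of_bool_def sum.delta')
      finally have "bst_avg n (?u ?t) \<le> 2 * E / real (Suc m)"
        unfolding avg by (intro divide_right_mono) auto
      also have "\<dots> = 2 / real (Suc m) * E" by simp
      also have "\<dots> \<le> exp (- entropy_toll K (size l) (size r)) * E"
        using toll eq(1) by (intro mult_right_mono) (auto simp: E_def)
      also have "\<dots> = exp (- entropy K ?t)"
        using eq(2) by (simp add: E_def flip: exp_add)
      finally show ?thesis .
    qed
    consider "l = Leaf" "r = Leaf" | "l = Leaf" "r \<noteq> Leaf" | "l \<noteq> Leaf" "r = Leaf" | "l \<noteq> Leaf" "r \<noteq> Leaf"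
      by blast
    then show ?thesis
    proof cases
      case 1
      have "bst_avg n (?u ?t) \<le> bst_avg n (\<lambda>_. 1)" by (intro bst_avg_mono) auto
      then show ?thesis using 1 by (simp add: entropy_toll_def)
    next
      case 2
      then show ?thesis using Node.IH by (intro unary[of r]) auto
    next
      case 3
      then show ?thesis using Node.IH by (intro unary[of l]) auto
    next
      case 4
      define E where "E = exp (- entropy K l) * exp (- entropy K r)"
      \<comment> \<open>The plane shape keeps the order of two children, so there is no mirror
        term.\<close>
      have "?A j \<le> of_bool (j = size l) * E" if "j \<le> m" for j
      proof -
        have "?A j \<le> bst_avg j (\<lambda>l'. bst_avg (m - j) (\<lambda>r'. ?u l l' * ?u r r'))"
          using 4 by (intro bst_avg_mono) auto
        also have "\<dots> = bst_avg j (?u l) * bst_avg (m - j) (?u r)"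
          unfolding bst_avg_cmult bst_avg_multc ..
        also have "\<dots> \<le> of_bool (j = size l) * E"
          using Node.IH 4 u_zero[of j l] unfolding E_def
          by (cases "j = size l") (auto intro!: mult_mono bst_avg_nonneg)
        finally show ?thesis .
      qed
      then have "(\<Sum>j\<le>m. ?A j) \<le> (\<Sum>j\<le>m. of_bool (j = size l) * E)"
        by (intro sum_mono) auto
      also have "\<dots> = E"
        by (simp add: sum_distrib_right[symmetric] of_bool_def sum.delta' m_def)
      finally have "bst_avg n (?u ?t) \<le> 1 / real (Suc m) * E"
        unfolding avg by (simp add: divide_right_mono)
      also have "\<dots> \<le> exp (- entropy_toll K (size l) (size r)) * E"
        using toll 4 by (intro mult_right_mono) (auto simp: E_def)
      also have "\<dots> = exp (- entropy K ?t)"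
        by (simp add: E_def flip: exp_add)
      finally show ?thesis .
    qed
  qed
qed simp

text \<open>The mean toll at size \<open>k\<close>: two of the \<open>k\<close> equally likely left
  sizes, 0 and \<open>k - 1\<close>, produce a unary vertex. At \<open>k = 1\<close> these coincide
  and the toll is 0 instead, hence sums start at 2.\<close>

definition shape_entropy :: "nat \<Rightarrow> real" where
  "shape_entropy k = ln (real k) - 2 * ln 2 / real k"

text \<open>A partial sum of the series for \<open>c15 / 2\<close>.\<close>

definition entropy_rate :: "nat \<Rightarrow> real" where
  "entropy_rate K = (\<Sum>k=2..K. 2 * shape_entropy k / ((real k + 1) * (real k + 2)))"

lemma bst_avg_entropy_node:
  "bst_avg (Suc m) (entropy_node K) =
     (if Suc m \<le> K \<and> m > 0 then shape_entropy (Suc m) else 0)"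
proof -
  have "bst_avg (Suc m) (entropy_node K) = (\<Sum>j\<le>m. entropy_toll K j (m - j)) / real (Suc m)"
  proof -
    have "bst_avg j (\<lambda>l. bst_avg (m - j) (\<lambda>r. entropy_node K (Node l () r))) = entropy_toll K j (m - j)" for j
      unfolding entropy_node_Node
      using bst_avg_size[of j "\<lambda>i. bst_avg (m - j) (\<lambda>r. entropy_toll K i (size r))"]
        bst_avg_size[of "m - j" "entropy_toll K j"] by simp
    then show ?thesis by (simp del: entropy_node_Node)
  qed
  also have "(\<Sum>j\<le>m. entropy_toll K j (m - j)) =
      (\<Sum>j\<le>m. of_bool (Suc m \<le> K) * (ln (real (Suc m)) - of_bool ((j = 0) \<noteq> (j = m)) * ln 2))"
    by (intro sum.cong) (auto simp: entropy_toll_def)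
  also have "\<dots> = of_bool (Suc m \<le> K) * (real (Suc m) * ln (real (Suc m)) -
      real (card {j \<in> {..m}. (j = 0) \<noteq> (j = m)}) * ln 2)"
    by (simp add: sum_distrib_left[symmetric] sum_subtractf sum_distrib_right[symmetric] Int_def
        del: of_nat_Suc)
  also have "{j \<in> {..m}. (j = 0) \<noteq> (j = m)} = (if m = 0 then {} else {0, m})" by auto
  finally show ?thesis
    by (cases "m = 0"; cases "Suc m \<le> K")
       (simp_all add: shape_entropy_def diff_divide_distrib del: bst_avg.simps of_nat_Suc)
qed

text \<open>For sizes above \<open>K\<close> the toll vanishes, so the sum in the closed form is
  constant and the mean is exactly proportional to \<open>n + 1\<close>.\<close>

lemma bst_avg_entropy:
  assumes "n > K"
  shows "bst_avg n (entropy K) = entropy_rate K * (real n + 1)"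
proof -
  have "(\<Sum>k=1..<n. 2 * bst_avg k (entropy_node K) / ((real k + 1) * (real k + 2))) = entropy_rate K"
    unfolding entropy_rate_def
  proof (intro sum.mono_neutral_cong_right ballI)
    fix k assume "k \<in> {1..<n} - {2..K}"
    then obtain i where "k = Suc i" "\<not> (Suc i \<le> K \<and> i > 0)" by (cases k) auto
    then show "2 * bst_avg k (entropy_node K) / ((real k + 1) * (real k + 2)) = 0"
      by (auto simp add: bst_avg_entropy_node simp del: bst_avg.simps)
  next
    fix k assume "k \<in> {2..K}"
    then obtain i where "k = Suc i" "Suc i \<le> K \<and> i > 0" by (cases k) auto
    then show "2 * bst_avg k (entropy_node K) / ((real k + 1) * (real k + 2)) =
        2 * shape_entropy k / ((real k + 1) * (real k + 2))"
      by (simp add: bst_avg_entropy_node del: bst_avg.simps)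
  qed (use assms in auto)
  moreover obtain i where "n = Suc i" "\<not> Suc i \<le> K" using assms by (cases n) auto
  ultimately show ?thesis
    using bst_avg_additive_closed_form[of "entropy K" "entropy_node K" n] assms
    by (simp add: bst_avg_entropy_node mult.commute del: bst_avg.simps)
qed

text \<open>Chebyshev's inequality: the deviation from the mean is of order n while the variance is
  linear. The constant depends on \<open>K\<close> and \<open>\<rho>\<close> but not on
  \<open>n\<close>.\<close>

lemma bst_avg_entropy_small:
  assumes "\<rho> < entropy_rate K" "0 < \<rho>"
  obtains C where "C \<ge> 0"
    "\<And>n. n > K \<Longrightarrow> bst_avg n (\<lambda>t. of_bool (entropy K t < \<rho> * real n)) \<le> C / real n"
proof -
  define \<mu> where "\<mu> = entropy_rate K"
  \<comment> \<open>Only the finitely many sizes up to \<open>K\<close> deviate from the linear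
    mean, so the sum of their errors bounds each error.\<close>
  define B where "B = (\<Sum>n\<le>K. \<bar>bst_avg n (entropy K) - \<mu> * (real n + 1)\<bar>)"
  have B: "\<bar>bst_avg n (entropy K) - \<mu> * (real n + 1)\<bar> \<le> B" for n
  proof (cases "n > K")
    case True
    then show ?thesis by (auto simp: bst_avg_entropy \<mu>_def B_def intro: sum_nonneg)
  next
    case False
    then show ?thesis unfolding B_def
      by (intro member_le_sum[of n "{..K}" "\<lambda>n. \<bar>bst_avg n (entropy K) - \<mu> * (real n + 1)\<bar>"]) auto
  qed
  define D where "D = (ln (real K + 1) + 3 * B)\<^sup>2"
  have V: "bst_avg n (\<lambda>t. (entropy K t - bst_avg n (entropy K))\<^sup>2) \<le> D * real n" for n
    unfolding D_def
    by (rule bst_avg_variance[where h = "entropy_toll K" and \<alpha> = \<mu>])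
       (use entropy_toll_bounds B in \<open>auto simp: abs_le_iff intro: order_trans[of _ 0]\<close>)
  show thesis
  proof (rule that[of "D / (\<mu> - \<rho>)\<^sup>2"])
    fix n assume n: "n > K"
    then have pos: "real n > 0" "\<mu> - \<rho> > 0" using assms by (auto simp: \<mu>_def)
    have "bst_avg n (\<lambda>t. of_bool (entropy K t < \<rho> * real n)) \<le>
        bst_avg n (\<lambda>t. (entropy K t - bst_avg n (entropy K))\<^sup>2) / ((\<mu> - \<rho>) * real n)\<^sup>2"
    proof (rule bst_avg_markov)
      fix t :: "unit tree" assume "entropy K t < \<rho> * real n"
      then have "(\<mu> - \<rho>) * real n \<le> bst_avg n (entropy K) - entropy K t"
        using n assms by (simp add: bst_avg_entropy \<mu>_def algebra_simps)
      then have "((\<mu> - \<rho>) * real n)\<^sup>2 \<le> (bst_avg n (entropy K) - entropy K t)\<^sup>2"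
        using pos by (intro power_mono) auto
      then show "((\<mu> - \<rho>) * real n)\<^sup>2 \<le> (entropy K t - bst_avg n (entropy K))\<^sup>2"
        by (simp add: power2_commute)
    qed (use pos in auto)
    also have "\<dots> \<le> D * real n / ((\<mu> - \<rho>) * real n)\<^sup>2"
      using V by (intro divide_right_mono) auto
    also have "\<dots> = D / (\<mu> - \<rho>)\<^sup>2 / real n"
      using pos by (simp add: power_mult_distrib power2_eq_square[of "real n"])
    finally show "bst_avg n (\<lambda>t. of_bool (entropy K t < \<rho> * real n)) \<le> D / (\<mu> - \<rho>)\<^sup>2 / real n" .
  qed (auto simp: D_def)
qed

section \<open>Bounds on the number of plane shapes\<close>

text \<open>A large vertex has a good or a bad shape. The vertices of good shape, of any size,
  exceed the number of distinct good shapes by exactly \<open>shape_excess\<close>.\<close>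

lemma num_plane_fringe_shapes_ge:
  "num_large k t - (fringe_sum (\<lambda>s. of_bool (k \<le> size s \<and> \<not> good (plane_shape s))) t + shape_excess good t)
     \<le> real (num_plane_fringe_shapes t)"
proof -
  have "num_large k t \<le> fringe_sum (\<lambda>s. of_bool (good (plane_shape s)) +
      of_bool (k \<le> size s \<and> \<not> good (plane_shape s))) t"
    by (intro fringe_sum_mono) auto
  then show ?thesis
    using card_fringe_shapes_le[of good t] by (simp add: fringe_sum_add shape_excess_def)
qed

text \<open>The right side solves the recurrence exactly for \<open>\<delta>\<close> times the toll
  of \<open>num_large\<close>, so it suffices to compare the average tolls.\<close>

lemma bst_avg_fringe_sum_large_le:
  assumes "\<And>m. k \<le> m \<Longrightarrow> bst_avg m (\<lambda>t. of_bool (P t)) \<le> \<delta>" "\<delta> \<ge> 0"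
  shows "bst_avg n (fringe_sum (\<lambda>t. of_bool (k \<le> size t \<and> P t))) \<le> \<delta> * bst_avg n (num_large k)"
proof (rule bst_avg_additive_le)
  fix m
  have "bst_avg (Suc m) (\<lambda>t. of_bool (k \<le> size t \<and> P t)) \<le> \<delta> * bst_avg (Suc m) (\<lambda>t. of_bool (k \<le> size t))"
  proof (cases "k \<le> Suc m")
    case True
    have "bst_avg (Suc m) (\<lambda>t. of_bool (k \<le> size t \<and> P t)) = bst_avg (Suc m) (\<lambda>t. of_bool (P t))"
      using True by (intro bst_avg_cong) auto
    also have "\<dots> \<le> \<delta>" using assms(1) True by blast
    also have "bst_avg (Suc m) (\<lambda>t. of_bool (k \<le> size t)) = (1 :: real)"
      using True by (subst bst_avg_size) simp
    ultimately show ?thesis by simp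
  next
    case False
    have "bst_avg (Suc m) (\<lambda>t. of_bool (k \<le> size t \<and> P t)) = bst_avg (Suc m) (\<lambda>t. 0)"
      using False by (intro bst_avg_cong) auto
    then have "bst_avg (Suc m) (\<lambda>t. of_bool (k \<le> size t \<and> P t)) = 0" by (simp only: bst_avg_const)
    moreover have "bst_avg (Suc m) (\<lambda>t. of_bool (k \<le> size t)) = (0 :: real)"
      using False by (subst bst_avg_size) simp
    ultimately show ?thesis by (simp only:)
  qed
  moreover have "bst_avg (Suc m) (num_large k) = bst_avg (Suc m) (\<lambda>t. of_bool (k \<le> size t)) +
      2 / real (Suc m) * (\<Sum>j\<le>m. bst_avg j (num_large k))"
    by (rule bst_avg_additive) simp
  ultimately show "bst_avg (Suc m) (\<lambda>t. of_bool (k \<le> size t \<and> P t)) +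
      2 / real (Suc m) * (\<Sum>j\<le>m. \<delta> * bst_avg j (num_large k)) \<le> \<delta> * bst_avg (Suc m) (num_large k)"
    unfolding sum_distrib_left[symmetric] by (simp only: distrib_left mult.left_commute)
qed auto

text \<open>Every fringe subtree of size at least \<open>k\<close> contributes its own shape, except for those whose
  shape is too likely and for the coincidences among the unlikely ones.\<close>

lemma num_plane_fringe_shapes_lower:
  assumes "\<rho> < entropy_rate K" "0 < \<rho>"
  shows "\<exists>C\<ge>0. \<forall>k>K. \<forall>n\<ge>k. \<exists>Y. (\<forall>t. 0 \<le> Y t) \<and>
        (\<forall>t. 2 * (real n + 1) / (real k + 1) - 1 - Y t \<le> real (num_plane_fringe_shapes t)) \<and>
        bst_avg n Y \<le> 25 * sqrt (real n) + C / real k * (2 * (real n + 1) / (real k + 1))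
          + 3 * exp (- \<rho> * real k) * (real n)\<^sup>2"
proof -
  obtain C where C: "C \<ge> 0"
    "\<And>n. n > K \<Longrightarrow> bst_avg n (\<lambda>t. of_bool (entropy K t < \<rho> * real n)) \<le> C / real n"
    using bst_avg_entropy_small[OF assms] by blast
  show ?thesis
  proof (intro exI[of _ C] conjI C(1) allI impI)
    fix k n :: nat assume k: "k > K" "n \<ge> k"
    define p where "p = exp (- \<rho> * real k)"
    \<comment> \<open>The bound is required at every nonempty size, since the excess estimate meets
      a shape in subtrees of all sizes. The threshold comes from size \<open>k\<close>; larger trees
      of typical entropy only have less likely shapes.\<close>
    define good where "good S \<longleftrightarrow>
      (\<forall>m. bst_avg (Suc m) (\<lambda>t. of_bool (plane_shape t = S)) \<le> p)" for S
    define bad where "bad = fringe_sum (\<lambda>s :: unit tree. of_bool (k \<le> size s \<and> \<not> good (plane_shape s)))"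
    define \<mu> where "\<mu> = bst_avg n (num_large k)"
    define Y where "Y t = \<bar>num_large k t - \<mu>\<bar> + (bad t + shape_excess good t)" for t
    have mean: "\<mu> = 2 * (real n + 1) / (real k + 1) - 1"
      using k by (simp add: \<mu>_def bst_avg_num_large)
    have goodI: "good (plane_shape t)" if "size t = m" "k \<le> m" "\<not> entropy K t < \<rho> * real m" for t :: "unit tree" and m
      unfolding good_def
    proof
      fix i
      have "t \<noteq> Leaf" using that k by auto
      have "bst_avg (Suc i) (\<lambda>s. of_bool (plane_shape s = plane_shape t)) =
          bst_avg (Suc i) (\<lambda>s. of_bool (s \<noteq> Leaf \<and> plane_shape s = plane_shape t))"
        by (intro bst_avg_cong) auto
      also have "\<dots> \<le> exp (- entropy K t)" by (rule bst_avg_plane_shape_le[OF \<open>t \<noteq> Leaf\<close>])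
      also have "\<rho> * real k \<le> \<rho> * real m"
        using that(2) assms(2) by (intro mult_left_mono) auto
      then have "exp (- entropy K t) \<le> p" using that(3) unfolding p_def by simp
      finally show "bst_avg (Suc i) (\<lambda>s. of_bool (plane_shape s = plane_shape t)) \<le> p" .
    qed
    have rare: "bst_avg m (\<lambda>t. of_bool (\<not> good (plane_shape t))) \<le> C / real k" if "k \<le> m" for m
    proof -
      have "bst_avg m (\<lambda>t. of_bool (\<not> good (plane_shape t))) \<le>
          bst_avg m (\<lambda>t. of_bool (entropy K t < \<rho> * real m))"
        using goodI that by (intro bst_avg_mono) auto
      also have "\<dots> \<le> C / real m" using C k that by auto
      also have "\<dots> \<le> C / real k" using C(1) k that by (intro divide_left_mono) auto
      finally show ?thesis .
    qed
    have "bst_avg n bad \<le> C / real k * \<mu>"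
      unfolding bad_def \<mu>_def using rare C(1) by (intro bst_avg_fringe_sum_large_le) auto
    also have "\<dots> \<le> C / real k * (2 * (real n + 1) / (real k + 1))"
      using mean C(1) by (intro mult_left_mono) auto
    finally have "bst_avg n Y \<le> 25 * sqrt (real n) + C / real k * (2 * (real n + 1) / (real k + 1))
          + 3 * exp (- \<rho> * real k) * (real n)\<^sup>2"
      using bst_avg_abs_num_large[of k n] bst_avg_shape_excess_le[of p good n] k
      unfolding Y_def bst_avg_add p_def[symmetric] \<mu>_def good_def by (auto simp: p_def)
    moreover have "0 \<le> Y t" for t
      unfolding Y_def bad_def by (intro add_nonneg_nonneg shape_excess_nonneg fringe_sum_nonneg) auto
    moreover have "2 * (real n + 1) / (real k + 1) - 1 - Y t \<le> real (num_plane_fringe_shapes t)" for t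
      using num_plane_fringe_shapes_ge[of k t good] mean unfolding Y_def bad_def by linarith
    ultimately show "\<exists>Y. (\<forall>t. 0 \<le> Y t) \<and>
        (\<forall>t. 2 * (real n + 1) / (real k + 1) - 1 - Y t \<le> real (num_plane_fringe_shapes t)) \<and>
        bst_avg n Y \<le> 25 * sqrt (real n) + C / real k * (2 * (real n + 1) / (real k + 1))
          + 3 * exp (- \<rho> * real k) * (real n)\<^sup>2"
      by blast
  qed
qed

lemma num_plane_fringe_shapes_upper:
  assumes "k > 0" "n > 0"
  shows "\<exists>Y. (\<forall>t. 0 \<le> Y t) \<and>
    (\<forall>t. real (num_plane_fringe_shapes t) \<le> 3 ^ k + 2 * (real n + 1) / (real k + 1) + Y t) \<and>
    bst_avg n Y \<le> 25 * sqrt (real n)"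
proof (intro exI conjI allI)
  let ?Y = "\<lambda>t. \<bar>num_large k t - bst_avg n (num_large k)\<bar>"
  show "bst_avg n ?Y \<le> 25 * sqrt (real n)" by (rule bst_avg_abs_num_large[OF assms])
  show "real (num_plane_fringe_shapes t) \<le> 3 ^ k + 2 * (real n + 1) / (real k + 1) + ?Y t" for t
    using num_plane_fringe_shapes_le[of t k] bst_avg_num_large_le[OF assms(1), of n] by linarith
qed simp

text \<open>For \<open>c < d < L\<close> the main term eventually exceeds
  \<open>d * n / ln n\<close>, so the event fails only where \<open>Y\<close> is at least
  \<open>(d - c) * n / ln n\<close>, and Markov's inequality applies. Taking \<open>G\<close> to be
  -J turns it into an upper bound.\<close>

lemma bst_lower_tail:
  fixes G :: "unit tree \<Rightarrow> real" and m e :: "nat \<Rightarrow> real"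
  assumes ev: "\<forall>\<^sub>F n in sequentially. \<exists>Y. (\<forall>t. 0 \<le> Y t) \<and> (\<forall>t. m n - Y t \<le> G t) \<and> bst_avg n Y \<le> e n"
    and m: "(\<lambda>n. m n * (ln (real n) / real n)) \<longlonglongrightarrow> L"
    and e: "(\<lambda>n. e n * (ln (real n) / real n)) \<longlonglongrightarrow> 0"
    and c: "c < L"
  shows "\<forall>\<^sub>F n in sequentially. c * real n / ln (real n) \<le> bst_avg n G"
    and "(\<lambda>n. bst_avg n (\<lambda>t. of_bool (c * real n / ln (real n) \<le> G t))) \<longlonglongrightarrow> 1"
proof -
  define w where "w n = ln (real n) / real n" for n :: nat
  obtain d where d: "c < d" "d < L" using c dense by blast
  have mw: "\<forall>\<^sub>F n in sequentially. d < m n * w n"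
    using order_tendstoD(1)[OF m d(2)] by (simp add: w_def)
  have ew: "\<forall>\<^sub>F n in sequentially. e n * w n < d - c"
    using order_tendstoD(2)[OF e, of "d - c"] d by (simp add: w_def)
  have w: "\<forall>\<^sub>F n in sequentially. 0 < w n \<and> c * real n / ln (real n) = c / w n"
    using eventually_ge_at_top[of 2] by eventually_elim (auto simp: w_def)
  show "\<forall>\<^sub>F n in sequentially. c * real n / ln (real n) \<le> bst_avg n G"
    using ev mw ew w
  proof eventually_elim
    case (elim n)
    then obtain Y where Y: "\<And>t. m n - Y t \<le> G t" "bst_avg n Y \<le> e n" by blast
    have "m n - bst_avg n Y \<le> bst_avg n G"
      using bst_avg_mono[of n "\<lambda>t. m n - Y t" G] Y by (simp add: bst_avg_diff)
    then have "m n - e n \<le> bst_avg n G" using Y(2) by linarith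
    moreover have "c / w n \<le> m n - e n" using elim by (simp add: field_simps)
    ultimately show ?case using elim by simp
  qed
  have lower: "\<forall>\<^sub>F n in sequentially. 1 - e n * w n / (d - c) \<le>
      bst_avg n (\<lambda>t. of_bool (c * real n / ln (real n) \<le> G t))"
    using ev mw w
  proof eventually_elim
    case (elim n)
    then obtain Y where Y: "\<And>t. m n - Y t \<le> G t" "\<And>t. 0 \<le> Y t" "bst_avg n Y \<le> e n" by blast
    have "bst_avg n (\<lambda>t. of_bool (\<not> c / w n \<le> G t)) \<le> bst_avg n Y / ((d - c) / w n)"
    proof (rule bst_avg_markov)
      fix t assume "\<not> c / w n \<le> G t"
      moreover have "d / w n < m n" using elim by (simp add: field_simps)
      ultimately show "(d - c) / w n \<le> Y t" using Y(1)[of t] by (simp add: diff_divide_distrib)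
    qed (use Y d elim in auto)
    also have "\<dots> \<le> e n / ((d - c) / w n)"
      using Y d elim by (intro divide_right_mono) auto
    also have "\<dots> = e n * w n / (d - c)" by simp
    also have "bst_avg n (\<lambda>t. of_bool (\<not> c / w n \<le> G t)) = 1 - bst_avg n (\<lambda>t. of_bool (c / w n \<le> G t))"
      by (simp add: of_bool_not_iff bst_avg_diff)
    finally show ?case using elim by simp
  qed
  have "(\<lambda>n. 1 - e n * w n / (d - c)) \<longlonglongrightarrow> 1 - 0 / (d - c)"
    using e d by (intro tendsto_intros) (auto simp: w_def)
  then have "(\<lambda>n. 1 - e n * w n / (d - c)) \<longlonglongrightarrow> 1" by simp
  moreover have "bst_avg n (\<lambda>t. of_bool (c * real n / ln (real n) \<le> G t)) \<le> 1" for n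
    using bst_avg_mono[of n "\<lambda>t. of_bool (c * real n / ln (real n) \<le> G t)" "\<lambda>_. 1"] by simp
  ultimately show "(\<lambda>n. bst_avg n (\<lambda>t. of_bool (c * real n / ln (real n) \<le> G t))) \<longlonglongrightarrow> 1"
    using lower by (intro tendsto_sandwich[OF lower _ _ tendsto_const]) auto
qed

section \<open>Asymptotics\<close>

lemma summable_on_log_series: "(\<lambda>k. ln (real k) / ((real k + 1) * (real k + 2))) summable_on {2..}"
proof -
  have "summable (\<lambda>k. ln (real k) / ((real k + 1) * (real k + 2)))"
  proof (rule summable_comparison_test_bigo)
    show "summable (\<lambda>k. norm (real k powr (-3/2)))" by (simp add: summable_real_powr_iff)
    show "(\<lambda>k. ln (real k) / ((real k + 1) * (real k + 2))) \<in> O(\<lambda>k. real k powr (-3/2))" by real_asymp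
  qed
  moreover have "0 \<le> ln (real k)" for k by (cases k) auto
  ultimately have "(\<lambda>k. ln (real k) / ((real k + 1) * (real k + 2))) summable_on UNIV"
    by (intro summable_nonneg_imp_summable_on) auto
  then show ?thesis by (rule summable_on_subset_banach) simp
qed

text \<open>By partial fractions the summand is half the difference of 1/(k(k+1)) and
  1/((k+1)(k+2)). The value 1/12, multiplied by 4 * 2 log 2, is the correction 2 log 2 / 3 in
  \<open>c15\<close>.\<close>

lemma has_sum_inverse_cubic:
  "((\<lambda>k. 1 / (real k * ((real k + 1) * (real k + 2)))) has_sum 1/12) {2..}"
proof -
  define f where "f k = 1 / (2 * ((real k + 2) * (real k + 3)))" for k :: nat
  have "(\<lambda>k. f k - f (Suc k)) sums (f 0 - 0)"
    by (rule telescope_sums') (unfold f_def, real_asymp)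
  also have "(\<lambda>k. f k - f (Suc k)) = (\<lambda>k. 1 / (real (k + 2) * ((real (k + 2) + 1) * (real (k + 2) + 2))))"
    by (rule ext) (simp add: f_def divide_simps, simp add: algebra_simps)
  also have "f 0 - 0 = 1/12" by (simp add: f_def)
  finally have "((\<lambda>k. 1 / (real k * ((real k + 1) * (real k + 2)))) \<circ> (\<lambda>k. k + 2) has_sum 1/12) UNIV"
    unfolding o_def by (intro sums_nonneg_imp_has_sum) auto
  then have "((\<lambda>k. 1 / (real k * ((real k + 1) * (real k + 2)))) has_sum 1/12) ((\<lambda>k. k + 2) ` UNIV)"
    by (subst has_sum_reindex) (auto intro: injI)
  moreover have "(\<lambda>k. k + 2) ` UNIV = {2::nat..}"
  proof (intro equalityI subsetI)
    fix x :: nat assume "x \<in> {2..}"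
    then have "x = (x - 2) + 2" by simp
    then show "x \<in> (\<lambda>k. k + 2) ` UNIV" by blast
  qed auto
  ultimately show ?thesis by simp
qed

lemma has_sum_shape_entropy:
  "((\<lambda>k. shape_entropy k / ((real k + 1) * (real k + 2))) has_sum
     ((\<Sum>\<^sub>\<infinity>k\<in>{2::nat..}. ln (real k) / ((real k + 1) * (real k + 2))) - ln 2 / 6)) {2..}"
proof -
  have "((\<lambda>k. ln (real k) / ((real k + 1) * (real k + 2))
          + - (2 * ln 2 * (1 / (real k * ((real k + 1) * (real k + 2)))))) has_sum
      ((\<Sum>\<^sub>\<infinity>k\<in>{2::nat..}. ln (real k) / ((real k + 1) * (real k + 2))) + - (2 * ln 2 * (1/12)))) {2..}"
    by (intro has_sum_add has_sum_uminusI has_sum_cmult_right has_sum_inverse_cubic has_sum_infsum summable_on_log_series)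
  then show ?thesis
    by (simp add: shape_entropy_def diff_divide_distrib)
qed

lemma c15_has_sum: "((\<lambda>k. shape_entropy k / ((real k + 1) * (real k + 2))) has_sum c15 / 4) {2..}"
  using has_sum_infsum[OF has_sum_imp_summable[OF has_sum_shape_entropy]]
  by (simp add: c15_def shape_entropy_def)

lemma c15_eq:
  "c15 = 4 * (\<Sum>\<^sub>\<infinity>k\<in>{2::nat..}. ln (real k) / ((real k + 1) * (real k + 2))) - 2 * ln 2 / 3"
  using has_sum_unique[OF c15_has_sum has_sum_shape_entropy] by simp

lemma shape_entropy_nonneg: "k \<ge> 2 \<Longrightarrow> 0 \<le> shape_entropy k"
proof -
  assume k: "k \<ge> 2"
  then have "2 * ln 2 / real k \<le> ln 2" by (simp add: field_simps)
  also have "\<dots> \<le> ln (real k)" using k by simp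
  finally show ?thesis by (simp add: shape_entropy_def)
qed

lemma c15_pos: "c15 > 0"
proof -
  \<comment> \<open>The term \<open>k = 2\<close> is zero, because both binary trees of size two
    have the same plane shape.\<close>
  have "0 < shape_entropy 3"
  proof -
    have "2 * ln 2 / 3 < ln (2::real)" by simp
    also have "ln (2::real) < ln 3" by simp
    finally show ?thesis by (simp add: shape_entropy_def)
  qed
  moreover have "(\<Sum>k\<in>{3}. shape_entropy k / ((real k + 1) * (real k + 2))) \<le> c15 / 4"
    using shape_entropy_nonneg by (intro finite_sum_le_has_sum[OF c15_has_sum]) auto
  ultimately show ?thesis by simp
qed

lemma entropy_rate_approx:
  assumes "\<sigma> < c15 / 2"
  obtains K where "\<sigma> < entropy_rate K"
proof -
  define g where "g k = shape_entropy k / ((real k + 1) * (real k + 2))" for k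
  obtain F where F: "finite F" "F \<subseteq> {2..}" "dist (sum g F) (c15 / 4) \<le> (c15 / 2 - \<sigma>) / 4"
    using has_sum_finite_approximation[OF c15_has_sum, of "(c15 / 2 - \<sigma>) / 4"] assms
    unfolding g_def by auto
  \<comment> \<open>The terms are nonnegative, so \<open>F\<close> may be enlarged to an initial
    segment; inserting 0 covers an empty \<open>F\<close>.\<close>
  have "sum g F \<le> sum g {2..Max (insert 0 F)}"
    using F shape_entropy_nonneg by (intro sum_mono2) (auto simp: g_def)
  also have "\<dots> = entropy_rate (Max (insert 0 F)) / 2"
    by (simp add: entropy_rate_def g_def sum_divide_distrib)
  finally have "2 * sum g F \<le> entropy_rate (Max (insert 0 F))" by simp
  moreover have "c15 / 4 - (c15 / 2 - \<sigma>) / 4 \<le> sum g F"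
    using F(3) unfolding dist_real_def by linarith
  then have "\<sigma> < 2 * sum g F" using assms by (simp add: field_simps)
  ultimately have "\<sigma> < entropy_rate (Max (insert 0 F))" by (rule less_le_trans[rotated])
  then show thesis by (rule that)
qed

section \<open>Choice of the size threshold\<close>

lemma num_plane_fringe_shapes_asymp_lower:
  assumes "c < c15"
  shows "\<forall>\<^sub>F n in sequentially. c * real n / ln (real n) \<le> bst_avg n (\<lambda>t. real (num_plane_fringe_shapes t))"
    and "(\<lambda>n. bst_avg n (\<lambda>t. of_bool (c * real n / ln (real n) \<le> real (num_plane_fringe_shapes t)))) \<longlonglongrightarrow> 1"
proof -
  obtain c' where c': "max c 0 < c'" "c' < c15"
    using dense[of "max c 0" c15] assms c15_pos by auto
  \<comment> \<open>With \<open>k\<close> about \<open>ln n / \<sigma>\<close>, the main term 2n/k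
    is about \<open>c' * n / ln n\<close>. Since \<open>\<rho> > \<sigma>\<close>, the repetitions
    number at most a constant times n to the power \<open>2 - \<rho> / \<sigma>\<close>, whose
    exponent is below 1.\<close>
  define \<sigma> where "\<sigma> = c' / 2"
  have \<sigma>: "\<sigma> > 0" "\<sigma> < c15 / 2" using c' by (auto simp: \<sigma>_def)
  obtain K where K: "\<sigma> < entropy_rate K" using entropy_rate_approx[OF \<sigma>(2)] .
  obtain \<rho> where \<rho>: "\<sigma> < \<rho>" "\<rho> < entropy_rate K" using dense[OF K] by blast
  have "0 < \<rho>" using \<rho> \<sigma> by simp
  obtain C where C: "C \<ge> 0"
    "\<forall>k>K. \<forall>n\<ge>k. \<exists>Y. (\<forall>t. 0 \<le> Y t) \<and>
        (\<forall>t. 2 * (real n + 1) / (real k + 1) - 1 - Y t \<le> real (num_plane_fringe_shapes t)) \<and>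
        bst_avg n Y \<le> 25 * sqrt (real n) + C / real k * (2 * (real n + 1) / (real k + 1))
          + 3 * exp (- \<rho> * real k) * (real n)\<^sup>2"
    using num_plane_fringe_shapes_lower[OF \<rho>(2) \<open>0 < \<rho>\<close>] by (elim exE conjE) (rule that)
  define x where "x n = ln (real n) / \<sigma>" for n :: nat
  \<comment> \<open>Main term and error are written in the real number \<open>x n\<close> instead of
    its ceiling \<open>k\<close>, so that they are elementary functions of \<open>n\<close>; the
    summand 2 absorbs the rounding in \<open>k + 1\<close>.\<close>
  define m where "m n = 2 * (real n + 1) / (x n + 2) - 1" for n :: nat
  define e where "e n = 25 * sqrt (real n) + C / x n * (2 * (real n + 1) / x n)
      + 3 * exp (- \<rho> * x n) * (real n)\<^sup>2" for n :: nat
  have ev: "\<forall>\<^sub>F n in sequentially. \<exists>Y. (\<forall>t. 0 \<le> Y t) \<and>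
      (\<forall>t. m n - Y t \<le> real (num_plane_fringe_shapes t)) \<and> bst_avg n Y \<le> e n"
  proof -
    have "\<forall>\<^sub>F n in sequentially. x n > max (real K) 0"
      unfolding x_def using \<sigma>(1) by real_asymp
    moreover have "\<forall>\<^sub>F n in sequentially. x n + 1 \<le> real n"
      unfolding x_def using \<sigma>(1) by real_asymp
    ultimately show ?thesis
    proof eventually_elim
      case (elim n)
      define k where "k = nat \<lceil>x n\<rceil>"
      have k: "x n \<le> real k" "real k \<le> x n + 1" using elim unfolding k_def by linarith+
      have kn: "k > K" "n \<ge> k" using elim k by linarith+
      obtain Y where Y: "\<forall>t. 0 \<le> Y t"
        "\<forall>t. 2 * (real n + 1) / (real k + 1) - 1 - Y t \<le> real (num_plane_fringe_shapes t)"
        "bst_avg n Y \<le> 25 * sqrt (real n) + C / real k * (2 * (real n + 1) / (real k + 1))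
          + 3 * exp (- \<rho> * real k) * (real n)\<^sup>2"
        using C(2)[THEN spec, THEN mp, OF kn(1), THEN spec, THEN mp, OF kn(2)]
        by (elim exE conjE) (rule that)
      have "m n \<le> 2 * (real n + 1) / (real k + 1) - 1"
        unfolding m_def using k elim by (intro diff_right_mono divide_left_mono) auto
      then have "m n - Y t \<le> real (num_plane_fringe_shapes t)" for t
        using Y(2)[THEN spec, of t] by linarith
      moreover have "25 * sqrt (real n) + C / real k * (2 * (real n + 1) / (real k + 1))
          + 3 * exp (- \<rho> * real k) * (real n)\<^sup>2 \<le> e n"
      proof -
        have x: "0 < x n" using elim by simp
        have "C / real k \<le> C / x n" using k x C(1) by (intro divide_left_mono) auto
        moreover have "2 * (real n + 1) / (real k + 1) \<le> 2 * (real n + 1) / x n"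
          using k x by (intro divide_left_mono) auto
        ultimately have "C / real k * (2 * (real n + 1) / (real k + 1)) \<le> C / x n * (2 * (real n + 1) / x n)"
          using x C(1) by (intro mult_mono) auto
        moreover have "3 * exp (- \<rho> * real k) * (real n)\<^sup>2 \<le> 3 * exp (- \<rho> * x n) * (real n)\<^sup>2"
          using k(1) \<open>0 < \<rho>\<close> by (intro mult_right_mono) auto
        ultimately show ?thesis unfolding e_def by linarith
      qed
      then have "bst_avg n Y \<le> e n" using Y(3) by linarith
      ultimately show ?case using Y(1) by (intro exI[of _ Y]) simp
    qed
  qed
  have m: "(\<lambda>n. m n * (ln (real n) / real n)) \<longlonglongrightarrow> c'"
  proof -
    have "(\<lambda>n. m n * (ln (real n) / real n)) \<longlonglongrightarrow> 2 * \<sigma>"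
      unfolding m_def x_def using \<sigma>(1) by (real_asymp simp: field_simps)
    then show ?thesis by (simp add: \<sigma>_def)
  qed
  define \<gamma> where "\<gamma> = \<rho> / \<sigma>"
  have \<gamma>: "\<gamma> > 1" using \<rho> \<sigma> by (simp add: \<gamma>_def)
  have e: "(\<lambda>n. e n * (ln (real n) / real n)) \<longlonglongrightarrow> 0"
  proof -
    have "(\<lambda>n. 25 * sqrt (real n) * (ln (real n) / real n)) \<longlonglongrightarrow> 0" by real_asymp
    moreover have "(\<lambda>n. C / x n * (2 * (real n + 1) / x n) * (ln (real n) / real n)) \<longlonglongrightarrow> 0"
    proof -
      have "(\<lambda>n. (1 / ln (real n)) * (2 * (real n + 1) / ln (real n)) * (ln (real n) / real n)) \<longlonglongrightarrow> 0"
        by real_asymp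
      from tendsto_mult_right_zero[OF this, of "C * \<sigma> * \<sigma>"]
      have "(\<lambda>n. C * \<sigma> * \<sigma> * ((1 / ln (real n)) * (2 * (real n + 1) / ln (real n)) * (ln (real n) / real n)))
          \<longlonglongrightarrow> 0" .
      moreover have "C / (u / \<sigma>) * (v / (u / \<sigma>)) * w = C * \<sigma> * \<sigma> * (1 / u * (v / u) * w)" for u v w
        by simp
      ultimately show ?thesis unfolding x_def by presburger
    qed
    moreover have "(\<lambda>n. 3 * exp (- \<rho> * x n) * (real n)\<^sup>2 * (ln (real n) / real n)) \<longlonglongrightarrow> 0"
    proof -
      have "(\<lambda>n. 3 * exp (- \<gamma> * ln (real n)) * (real n)\<^sup>2 * (ln (real n) / real n)) \<longlonglongrightarrow> 0"
        using \<gamma> by real_asymp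
      then show ?thesis by (simp add: x_def \<gamma>_def)
    qed
    ultimately have "(\<lambda>n. 25 * sqrt (real n) * (ln (real n) / real n) +
        C / x n * (2 * (real n + 1) / x n) * (ln (real n) / real n) +
        3 * exp (- \<rho> * x n) * (real n)\<^sup>2 * (ln (real n) / real n)) \<longlonglongrightarrow> 0 + 0 + 0"
      by (intro tendsto_add)
    then show ?thesis unfolding e_def distrib_right by simp
  qed
  have c: "c < c'" using c' by simp
  show "\<forall>\<^sub>F n in sequentially. c * real n / ln (real n) \<le> bst_avg n (\<lambda>t. real (num_plane_fringe_shapes t))"
    and "(\<lambda>n. bst_avg n (\<lambda>t. of_bool (c * real n / ln (real n) \<le> real (num_plane_fringe_shapes t)))) \<longlonglongrightarrow> 1"
    by (rule bst_lower_tail[OF ev m e c])+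
qed

lemma num_plane_fringe_shapes_asymp_upper:
  assumes "c > c16"
  shows "\<forall>\<^sub>F n in sequentially. bst_avg n (\<lambda>t. real (num_plane_fringe_shapes t)) \<le> c * real n / ln (real n)"
    and "(\<lambda>n. bst_avg n (\<lambda>t. of_bool (real (num_plane_fringe_shapes t) \<le> c * real n / ln (real n)))) \<longlonglongrightarrow> 1"
proof -
  have ln3: "ln (3::real) > 0" by simp
  have "c > 0" using assms ln3 unfolding c16_def by linarith
  then have "2 * ln 3 / c < 1" using assms by (simp add: c16_def)
  then obtain \<theta> where \<theta>: "2 * ln 3 / c < \<theta>" "\<theta> < 1" using dense by blast
  have "0 < 2 * ln 3 / c" using \<open>c > 0\<close> ln3 by simp
  then have \<theta>0: "\<theta> > 0" using \<theta> by linarith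
  \<comment> \<open>For \<open>k\<close> about \<open>\<tau> * ln n\<close> the small shapes number
    at most n to the power \<open>\<theta>\<close>, with \<open>\<theta> < 1\<close>, while the
    large subtrees give the factor \<open>2 / \<tau> = 2 * ln 3 / \<theta>\<close>, which is below
    \<open>c\<close> by the choice of \<open>\<theta>\<close>.\<close>
  define \<tau> where "\<tau> = \<theta> / ln 3"
  have \<tau>: "\<tau> > 0" using \<theta>0 ln3 by (simp add: \<tau>_def)
  define m where "m n = - (exp (\<theta> * ln (real n)) + 2 * (real n + 1) / (\<tau> * ln (real n)))" for n :: nat
  let ?G = "\<lambda>t :: unit tree. - real (num_plane_fringe_shapes t)"
  have ev: "\<forall>\<^sub>F n in sequentially. \<exists>Y. (\<forall>t. 0 \<le> Y t) \<and> (\<forall>t. m n - Y t \<le> ?G t) \<and>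
      bst_avg n Y \<le> 25 * sqrt (real n)"
  proof -
    have "\<forall>\<^sub>F n in sequentially. \<tau> * ln (real n) > 1" using \<tau> by real_asymp
    then show ?thesis using eventually_gt_at_top[of 0]
    proof eventually_elim
      case (elim n)
      define k where "k = nat \<lfloor>\<tau> * ln (real n)\<rfloor>"
      have k: "real k \<le> \<tau> * ln (real n)" "\<tau> * ln (real n) \<le> real k + 1"
        using elim unfolding k_def by linarith+
      then have "k > 0" using elim by linarith
      obtain Y where Y: "\<forall>t. 0 \<le> Y t"
        "\<forall>t. real (num_plane_fringe_shapes t) \<le> 3 ^ k + 2 * (real n + 1) / (real k + 1) + Y t"
        "bst_avg n Y \<le> 25 * sqrt (real n)"
        using num_plane_fringe_shapes_upper[OF \<open>k > 0\<close> elim(2)] by (elim exE conjE) (rule that)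
      have "(3::real) ^ k = exp (real k * ln 3)" by (simp add: exp_of_nat_mult)
      also have "\<dots> \<le> exp (\<tau> * ln (real n) * ln 3)" using k ln3 by simp
      also have "\<tau> * ln (real n) * ln 3 = \<theta> * ln (real n)" using ln3 by (simp add: \<tau>_def)
      finally have "(3::real) ^ k \<le> exp (\<theta> * ln (real n))" .
      moreover have "2 * (real n + 1) / (real k + 1) \<le> 2 * (real n + 1) / (\<tau> * ln (real n))"
        using k elim by (intro divide_left_mono) auto
      ultimately have "m n - Y t \<le> ?G t" for t
        using Y(2)[THEN spec, of t] unfolding m_def by linarith
      then show ?case using Y(1,3) by (intro exI[of _ Y]) simp
    qed
  qed
  have m: "(\<lambda>n. m n * (ln (real n) / real n)) \<longlonglongrightarrow> - (2 / \<tau>)"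
    unfolding m_def using \<theta>0 \<theta>(2) \<tau> by (real_asymp simp: field_simps)
  have e: "(\<lambda>n. 25 * sqrt (real n) * (ln (real n) / real n)) \<longlonglongrightarrow> 0" by real_asymp
  have c: "- c < - (2 / \<tau>)" using \<theta> \<theta>0 ln3 \<open>c > 0\<close> by (simp add: \<tau>_def field_simps)
  have neg: "- c * real n / ln (real n) \<le> - y \<longleftrightarrow> y \<le> c * real n / ln (real n)" for n y by simp
  note tail = bst_lower_tail[of m ?G, OF ev m e c]
  show "\<forall>\<^sub>F n in sequentially. bst_avg n (\<lambda>t. real (num_plane_fringe_shapes t)) \<le> c * real n / ln (real n)"
    using tail(1) bst_avg_cmult[of _ "-1" "\<lambda>t. real (num_plane_fringe_shapes t)"] by simp
  show "(\<lambda>n. bst_avg n (\<lambda>t. of_bool (real (num_plane_fringe_shapes t) \<le> c * real n / ln (real n)))) \<longlonglongrightarrow> 1"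
    using tail(2) unfolding neg .
qed

text \<open>This turns "for every fixed relative error" into the o(1) of the theorem: the error is
  lowered to the next 1/(i+1) only after the limit for it has become effective.\<close>

lemma diagonal_tendsto:
  fixes p :: "real \<Rightarrow> nat \<Rightarrow> real"
  assumes "\<And>\<eta>. \<eta> > 0 \<Longrightarrow> p \<eta> \<longlonglongrightarrow> L"
  obtains \<eta> where "\<eta> \<longlonglongrightarrow> 0" "(\<lambda>n. p (\<eta> n) n) \<longlonglongrightarrow> L"
proof -
  have "\<exists>N. \<forall>n\<ge>N. norm (p (inverse (real (Suc i))) n - L) < inverse (real (Suc i))" for i
    using LIMSEQ_D[OF assms[of "inverse (real (Suc i))"], of "inverse (real (Suc i))"] by auto
  then obtain N where N: "\<And>i n. n \<ge> N i \<Longrightarrow> norm (p (inverse (real (Suc i))) n - L) < inverse (real (Suc i))"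
    by metis
  \<comment> \<open>The largest index whose threshold has been passed; the condition
    \<open>i \<le> n\<close> makes the set finite, and the default 0 is legitimate from
    \<open>N 0\<close> on.\<close>
  define M where "M n = Max (insert 0 {i. i \<le> n \<and> N i \<le> n})" for n
  have M_ge: "i \<le> M n" if "i \<le> n" "N i \<le> n" for i n
    using that unfolding M_def by (intro Max_ge) auto
  have "filterlim M at_top sequentially"
    unfolding filterlim_at_top
  proof
    fix i
    show "\<forall>\<^sub>F n in sequentially. i \<le> M n"
      using eventually_ge_at_top[of "max i (N i)"] by eventually_elim (auto intro: M_ge)
  qed
  from filterlim_compose[OF LIMSEQ_inverse_real_of_nat this]
  have lim: "(\<lambda>n. inverse (real (Suc (M n)))) \<longlonglongrightarrow> 0" .
  have close: "\<forall>\<^sub>F n in sequentially. norm (p (inverse (real (Suc (M n)))) n - L) \<le> inverse (real (Suc (M n)))"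
    using eventually_ge_at_top[of "N 0"]
  proof eventually_elim
    case (elim n)
    have "M n \<in> insert 0 {i. i \<le> n \<and> N i \<le> n}" unfolding M_def by (intro Max_in) auto
    then have "N (M n) \<le> n" using elim by auto
    then show ?case using N less_imp_le by blast
  qed
  have "(\<lambda>n. p (inverse (real (Suc (M n)))) n - L) \<longlonglongrightarrow> 0"
    by (rule Lim_null_comparison[OF close lim])
  from that[OF lim LIM_zero_cancel[OF this]] show thesis .
qed

theorem theorem15:
  shows "c15 = 4 * (\<Sum>\<^sub>\<infinity>k\<in>{2::nat..}. ln (real k) / ((real k + 1) * (real k + 2))) - 2 * ln 2 / 3
    \<and> (\<exists>\<epsilon> \<delta> :: nat \<Rightarrow> real. \<epsilon> \<longlonglongrightarrow> 0 \<and> \<delta> \<longlonglongrightarrow> 0 \<and>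
         (\<forall>\<^sub>F n in sequentially.
            c15 * real n / ln (real n) * (1 + \<epsilon> n)
              \<le> measure_pmf.expectation (random_binary_increasing_tree n)
                  (\<lambda>t. real (num_plane_fringe_shapes t)) \<and>
            measure_pmf.expectation (random_binary_increasing_tree n)
                (\<lambda>t. real (num_plane_fringe_shapes t))
              \<le> c16 * real n / ln (real n) * (1 + \<delta> n)))
    \<and> (\<exists>\<epsilon> \<delta> :: nat \<Rightarrow> real. \<epsilon> \<longlonglongrightarrow> 0 \<and> \<delta> \<longlonglongrightarrow> 0 \<and>
         (\<lambda>n. measure_pmf.prob (random_binary_increasing_tree n)
            {t. c15 * real n / ln (real n) * (1 + \<epsilon> n) \<le> real (num_plane_fringe_shapes t) \<and>
                real (num_plane_fringe_shapes t) \<le> c16 * real n / ln (real n) * (1 + \<delta> n)})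
           \<longlonglongrightarrow> 1)"
proof -
  define J :: "unit tree \<Rightarrow> real" where "J t = real (num_plane_fringe_shapes t)" for t
  have J: "real (num_plane_fringe_shapes t) = J (unlabel t)" for t :: "nat tree"
    by (simp add: J_def num_plane_fringe_shapes_map_tree)
  define a b where "a \<eta> n = c15 * real n / ln (real n) * (1 + - \<eta>)"
    and "b \<eta> n = c16 * real n / ln (real n) * (1 + \<eta>)" for \<eta> n
  have c16: "c16 > 0" by (simp add: c16_def)
  have lower: "\<forall>\<^sub>F n in sequentially. a \<eta> n \<le> bst_avg n J"
    "(\<lambda>n. bst_avg n (\<lambda>t. of_bool (a \<eta> n \<le> J t))) \<longlonglongrightarrow> 1" if "\<eta> > 0" for \<eta>
  proof -
    have "c15 * (1 - \<eta>) < c15" using c15_pos that by (simp add: algebra_simps)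
    moreover have "c15 * (1 - \<eta>) * real n / ln (real n) = a \<eta> n" for n by (simp add: a_def)
    ultimately show "\<forall>\<^sub>F n in sequentially. a \<eta> n \<le> bst_avg n J"
      "(\<lambda>n. bst_avg n (\<lambda>t. of_bool (a \<eta> n \<le> J t))) \<longlonglongrightarrow> 1"
      using num_plane_fringe_shapes_asymp_lower[of "c15 * (1 - \<eta>)"] unfolding J_def by simp_all
  qed
  have upper: "\<forall>\<^sub>F n in sequentially. bst_avg n J \<le> b \<eta> n"
    "(\<lambda>n. bst_avg n (\<lambda>t. of_bool (J t \<le> b \<eta> n))) \<longlonglongrightarrow> 1" if "\<eta> > 0" for \<eta>
  proof -
    have "c16 < c16 * (1 + \<eta>)" using c16 that by (simp add: algebra_simps)
    moreover have "c16 * (1 + \<eta>) * real n / ln (real n) = b \<eta> n" for n by (simp add: b_def)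
    ultimately show "\<forall>\<^sub>F n in sequentially. bst_avg n J \<le> b \<eta> n"
      "(\<lambda>n. bst_avg n (\<lambda>t. of_bool (J t \<le> b \<eta> n))) \<longlonglongrightarrow> 1"
      using num_plane_fringe_shapes_asymp_upper[of "c16 * (1 + \<eta>)"] unfolding J_def by simp_all
  qed

  \<comment> \<open>The bound on the mean is encoded as a 0-1 sequence tending to 1, so that the
    diagonal argument covers it as well as the probabilities.\<close>
  define p where "p \<eta> n = (of_bool (a \<eta> n \<le> bst_avg n J \<and> bst_avg n J \<le> b \<eta> n) :: real)" for \<eta> n
  have p: "p \<eta> \<longlonglongrightarrow> 1" if "\<eta> > 0" for \<eta>
    using eventually_conj[OF lower(1)[OF that] upper(1)[OF that]]
    by (intro tendsto_eventually) (simp add: p_def)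
  obtain \<eta> where \<eta>: "\<eta> \<longlonglongrightarrow> 0" "(\<lambda>n. p (\<eta> n) n) \<longlonglongrightarrow> 1"
    using diagonal_tendsto[of p, OF p] .
  have "\<forall>\<^sub>F n in sequentially. 0 < p (\<eta> n) n"
    using order_tendstoD(1)[OF \<eta>(2), of 0] by simp
  then have mean: "\<forall>\<^sub>F n in sequentially. a (\<eta> n) n \<le> bst_avg n J \<and> bst_avg n J \<le> b (\<eta> n) n"
    by eventually_elim (simp add: p_def split: if_splits)

  define q where "q \<eta> n = bst_avg n (\<lambda>t. of_bool (a \<eta> n \<le> J t \<and> J t \<le> b \<eta> n))" for \<eta> n
  have q: "q \<eta> \<longlonglongrightarrow> 1" if "\<eta> > 0" for \<eta>
  proof (rule tendsto_sandwich[OF _ _ _ tendsto_const])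
    show "(\<lambda>n. bst_avg n (\<lambda>t. of_bool (a \<eta> n \<le> J t)) + bst_avg n (\<lambda>t. of_bool (J t \<le> b \<eta> n)) - 1) \<longlonglongrightarrow> 1"
      using tendsto_diff[OF tendsto_add[OF lower(2)[OF that] upper(2)[OF that]] tendsto_const[of 1]] by simp
    \<comment> \<open>Bonferroni's inequality: two events of probability tending to 1 occur jointly
      with probability tending to 1.\<close>
    have "bst_avg n (\<lambda>t. of_bool (a \<eta> n \<le> J t) + of_bool (J t \<le> b \<eta> n) - 1) \<le> q \<eta> n" for n
      unfolding q_def by (intro bst_avg_mono) auto
    then show "\<forall>\<^sub>F n in sequentially. bst_avg n (\<lambda>t. of_bool (a \<eta> n \<le> J t)) +
        bst_avg n (\<lambda>t. of_bool (J t \<le> b \<eta> n)) - 1 \<le> q \<eta> n"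
      by (simp add: bst_avg_add bst_avg_diff)
    have "q \<eta> n \<le> bst_avg n (\<lambda>_. 1)" for n unfolding q_def by (intro bst_avg_mono) auto
    then show "\<forall>\<^sub>F n in sequentially. q \<eta> n \<le> 1" by simp
  qed
  obtain \<zeta> where \<zeta>: "\<zeta> \<longlonglongrightarrow> 0" "(\<lambda>n. q (\<zeta> n) n) \<longlonglongrightarrow> 1"
    using diagonal_tendsto[of q, OF q] .

  have expectation: "measure_pmf.expectation (random_binary_increasing_tree n)
      (\<lambda>t. real (num_plane_fringe_shapes t)) = bst_avg n J" for n
    by (rule expectation_random_binary_increasing_tree) (rule J)
  have prob: "measure_pmf.prob (random_binary_increasing_tree n)
      {t. c15 * real n / ln (real n) * (1 + - \<zeta> n) \<le> real (num_plane_fringe_shapes t) \<and>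
          real (num_plane_fringe_shapes t) \<le> c16 * real n / ln (real n) * (1 + \<zeta> n)} = q (\<zeta> n) n" for n
    unfolding q_def a_def b_def by (rule prob_random_binary_increasing_tree) (simp only: J)
  have neg: "(\<lambda>n. - \<eta> n) \<longlonglongrightarrow> 0" "(\<lambda>n. - \<zeta> n) \<longlonglongrightarrow> 0"
    using tendsto_minus[OF \<eta>(1)] tendsto_minus[OF \<zeta>(1)] by simp_all
  show ?thesis
  proof (intro conjI)
    show "c15 = 4 * (\<Sum>\<^sub>\<infinity>k\<in>{2::nat..}. ln (real k) / ((real k + 1) * (real k + 2))) - 2 * ln 2 / 3"
      by (rule c15_eq)
  next
    show "\<exists>\<epsilon> \<delta> :: nat \<Rightarrow> real. \<epsilon> \<longlonglongrightarrow> 0 \<and> \<delta> \<longlonglongrightarrow> 0 \<and> (\<forall>\<^sub>F n in sequentially.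
        c15 * real n / ln (real n) * (1 + \<epsilon> n) \<le> measure_pmf.expectation (random_binary_increasing_tree n)
            (\<lambda>t. real (num_plane_fringe_shapes t)) \<and>
        measure_pmf.expectation (random_binary_increasing_tree n) (\<lambda>t. real (num_plane_fringe_shapes t))
          \<le> c16 * real n / ln (real n) * (1 + \<delta> n))"
      unfolding expectation using mean \<eta>(1) neg(1)
      by (intro exI[of _ "\<lambda>n. - \<eta> n"] exI[of _ \<eta>]) (simp add: a_def b_def)
  next
    show "\<exists>\<epsilon> \<delta> :: nat \<Rightarrow> real. \<epsilon> \<longlonglongrightarrow> 0 \<and> \<delta> \<longlonglongrightarrow> 0 \<and>
        (\<lambda>n. measure_pmf.prob (random_binary_increasing_tree n)
          {t. c15 * real n / ln (real n) * (1 + \<epsilon> n) \<le> real (num_plane_fringe_shapes t) \<and>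
              real (num_plane_fringe_shapes t) \<le> c16 * real n / ln (real n) * (1 + \<delta> n)}) \<longlonglongrightarrow> 1"
    proof (intro exI conjI)
      show "(\<lambda>n. measure_pmf.prob (random_binary_increasing_tree n)
          {t. c15 * real n / ln (real n) * (1 + - \<zeta> n) \<le> real (num_plane_fringe_shapes t) \<and>
              real (num_plane_fringe_shapes t) \<le> c16 * real n / ln (real n) * (1 + \<zeta> n)}) \<longlonglongrightarrow> 1"
        unfolding prob by (rule \<zeta>(2))
    qed (rule neg(2) \<zeta>(1))+
  qed
qed

end
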